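(* Let $\mathbb{G}$ be the canonical neutral Kähler metric on $TS^2$ (respectively $TH^2$), where $TS^2$ is identified with the space of oriented lines of Euclidean 3-space $\mathbb{E}^3$ (respectively $TH^2$ with the space of future-pointing time-like lines of Lorentzian 3-space $\mathbb{E}^3_1$). Then the geodesics of $\mathbb{G}$ are generated by 1-parameter subgroups (transvections) of the Euclidean (respectively Lorentzian) isometry group; that is, every geodesic of $\mathbb{G}$ is the orbit of a line under a 1-parameter subgroup of the isometry group of $\mathbb{E}^3$ (respectively $\mathbb{E}^3_1$), acting on the space of lines.
   Context: $\mathbb{E}^3_1$ is $\mathbb{R}^3$ with the flat metric $(dx^1)^2+(dx^2)^2-(dx^3)^2$; write $z=x^1+ix^2$, $t=x^3$ (also on $\mathbb{E}^3$). $S^2$ and $H^2$ carry the metrics $g=e^{2u}d\xi d\bar\xi$ with $e^{2u}=4(1\pm\xi\bar\xi)^{-2}$, upper sign for $S^2$, lower sign (with $|\xi|<1$) for $H^2$. Throughout, upper signs are Euclidean and lower signs Lorentzian. Identification with lines: writing $(\xi,\eta)$ for the tangent vector $\eta\,\partial/\partial\xi+\bar\eta\,\partial/\partial\bar\xi\in T_\xi N$, $N=S^2$ or $H^2$, the corresponding line is the set of points $(z,t)$, $r\in\mathbb{R}$, with $$z=\frac{2(\eta\mp\bar\eta\xi^2)+2\xi(1\pm\xi\bar\xi)r}{(1\pm\xi\bar\xi)^2},\qquad t=\frac{\mp2(\eta\bar\xi+\bar\eta\xi)+(1-\xi^2\bar\xi^2)r}{(1\pm\xi\bar\xi)^2},$$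 oriented by increasing $r$. Isometries (in the identity component) of $\mathbb{E}^3$ (resp. $\mathbb{E}^3_1$) act on these lines, hence on $TS^2$ (resp. $TH^2$). Canonical neutral Kähler metric on $TN$ for a Riemannian 2-manifold $(N,g=e^{2u}d\xi d\bar\xi)$: in the coordinates $(\xi,\eta)$, $$\mathbb{G}=2\,\mathrm{Im}\left(e^{2u}d\bar\eta\, d\xi-\eta\,\partial(e^{2u})d\xi\, d\bar\xi\right),\qquad \partial=\partial/\partial\xi .$$ The paper refers to the 1-parameter subgroups occurring here as transvections. *)

theory Defs
  imports "HOL-Analysis.Analysis"
begin

text \<open>
  Points of the ambient space are pairs \<open>(z, t)\<close> with \<open>z = x\<^sup>1 + i x\<^sup>2\<close> and \<open>t = x\<^sup>3\<close>.
  The parameter \<open>\<epsilon>\<close> is the sign in the ambient metric: \<open>\<epsilon> = 1\<close> is the Euclidean case with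
  \<open>N = S\<^sup>2\<close>, and \<open>\<epsilon> = -1\<close> the Lorentzian case with \<open>N = H\<^sup>2\<close>.
\<close>

type_synonym point = "complex \<times> real"

definition flat :: "real \<Rightarrow> point \<Rightarrow> point \<Rightarrow> real" where
  "flat \<epsilon> v w = fst v \<bullet> fst w + \<epsilon> * (snd v * snd w)"


subsection \<open>Oriented lines\<close>

text \<open>
  An oriented line is encoded as the linear order \<open>{(x, y). x precedes or equals y}\<close> on its
  set of points.
\<close>

type_synonym oline = "(point \<times> point) set"

definition oriented_line :: "point \<Rightarrow> point \<Rightarrow> oline" where
  "oriented_line q v = {(q + r *\<^sub>R v, q + r' *\<^sub>R v) | r r'. r \<le> r'}"

definition lines :: "real \<Rightarrow> oline set" where
  "lines \<epsilon> = {oriented_line q v | q v.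
     if \<epsilon> = 1 then v \<noteq> 0 else flat \<epsilon> v v < 0 \<and> snd v > 0}"

definition act :: "(point \<Rightarrow> point) \<Rightarrow> oline \<Rightarrow> oline" where
  "act f l = map_prod f f ` l"


subsection \<open>Isometries and one-parameter subgroups\<close>

definition isometries :: "real \<Rightarrow> (point \<Rightarrow> point) set" where
  "isometries \<epsilon> = {(\<lambda>x. A x + b) | A b.
     linear A \<and> (\<forall>v w. flat \<epsilon> (A v) (A w) = flat \<epsilon> v w)}"

text \<open>
  On affine maps the group topology is that of pointwise convergence. Being continuous with
  \<open>\<phi> 0 = id\<close>, a one-parameter subgroup stays in the identity component.
\<close>

definition one_parameter_subgroup :: "real \<Rightarrow> (real \<Rightarrow> point \<Rightarrow> point) \<Rightarrow> bool" where
  "one_parameter_subgroup \<epsilon> \<phi> \<longleftrightarrow>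
     (\<forall>s. \<phi> s \<in> isometries \<epsilon>) \<and> \<phi> 0 = id \<and> (\<forall>s t. \<phi> (s + t) = \<phi> s \<circ> \<phi> t) \<and>
     (\<forall>x. continuous_on UNIV (\<lambda>s. \<phi> s x))"


subsection \<open>Holomorphic coordinates on the space of oriented lines\<close>

definition line_point :: "real \<Rightarrow> complex \<Rightarrow> complex \<Rightarrow> real \<Rightarrow> point" where
  "line_point \<epsilon> \<xi> \<eta> r =
     (let e = complex_of_real \<epsilon>; d = (1 + e * \<xi> * cnj \<xi>)\<^sup>2 in
       ((2 * (\<eta> - e * cnj \<eta> * \<xi>\<^sup>2) + 2 * \<xi> * (1 + e * \<xi> * cnj \<xi>) * of_real r) / d,
        Re ((- 2 * e * (\<eta> * cnj \<xi> + cnj \<eta> * \<xi>) + (1 - \<xi>\<^sup>2 * (cnj \<xi>)\<^sup>2) * of_real r) / d)))"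

definition line_of :: "real \<Rightarrow> complex \<times> complex \<Rightarrow> oline" where
  "line_of \<epsilon> = (\<lambda>(\<xi>, \<eta>). {(line_point \<epsilon> \<xi> \<eta> r, line_point \<epsilon> \<xi> \<eta> r') | r r'. r \<le> r'})"

definition coord_dom :: "real \<Rightarrow> (complex \<times> complex) set" where
  "coord_dom \<epsilon> = {(\<xi>, \<eta>). \<epsilon> = 1 \<or> cmod \<xi> < 1}"

text \<open>
  On \<open>TH\<^sup>2\<close> the coordinates \<open>(\<xi>, \<eta>)\<close> are global. On \<open>TS\<^sup>2\<close> they miss the fibre over the south
  pole \<open>\<xi> = \<infinity>\<close>, where \<open>\<xi>' = 1/\<xi>\<close> is the conformal coordinate, with induced fibre coordinate
  \<open>\<eta>' = - \<eta>/\<xi>\<^sup>2\<close> and the same conformal factor \<open>4 (1 + \<xi>' \<xi>'\<^sup>*)\<^sup>-\<^sup>2\<close>. The line with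
  coordinates \<open>(\<xi>', \<eta>')\<close> is the image of \<open>line_of 1 (\<xi>', \<eta>')\<close> under the half-turn about the
  \<open>x\<^sup>1\<close>-axis, see lemma \<open>south_chart\<close> below.
\<close>

definition half_turn :: "point \<Rightarrow> point" where
  "half_turn = (\<lambda>(z, t). (cnj z, - t))"

definition charts :: "real \<Rightarrow> (complex \<times> complex \<Rightarrow> oline) set" where
  "charts \<epsilon> = (if \<epsilon> = 1 then {line_of \<epsilon>, act half_turn \<circ> line_of \<epsilon>} else {line_of \<epsilon>})"


subsection \<open>The canonical neutral metric\<close>

text \<open>\<open>conf \<epsilon>\<close> is \<open>e\<^sup>2\<^sup>u\<close> for the metric \<open>e\<^sup>2\<^sup>u d\<xi> d\<xi>\<^sup>*\<close> on \<open>N\<close>.\<close>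

definition conf :: "real \<Rightarrow> complex \<Rightarrow> real" where
  "conf \<epsilon> \<xi> = 4 / (1 + \<epsilon> * (cmod \<xi>)\<^sup>2)\<^sup>2"

text \<open>The Wirtinger derivative \<open>\<partial>/\<partial>\<xi>\<close> of a real-valued function.\<close>

definition wirtinger :: "(complex \<Rightarrow> real) \<Rightarrow> complex \<Rightarrow> complex" where
  "wirtinger f \<xi> = (of_real (frechet_derivative f (at \<xi>) 1)
                   - \<i> * of_real (frechet_derivative f (at \<xi>) \<i>)) / 2"

text \<open>
  The symmetric bilinear form of \<open>2 Im (e\<^sup>2\<^sup>u d\<eta>\<^sup>* d\<xi> - \<eta> \<partial>(e\<^sup>2\<^sup>u) d\<xi> d\<xi>\<^sup>*)\<close>, with the products
  of one-forms read as symmetrised products \<open>\<alpha> \<beta> = (\<alpha> \<otimes> \<beta> + \<beta> \<otimes> \<alpha>) / 2\<close>.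
\<close>

definition neutral_metric ::
  "(complex \<Rightarrow> real) \<Rightarrow> complex \<times> complex \<Rightarrow> complex \<times> complex \<Rightarrow> complex \<times> complex \<Rightarrow> real" where
  "neutral_metric E = (\<lambda>(\<xi>, \<eta>) (d\<xi>\<^sub>1, d\<eta>\<^sub>1) (d\<xi>\<^sub>2, d\<eta>\<^sub>2).
     2 * Im (of_real (E \<xi>) * ((cnj d\<eta>\<^sub>1 * d\<xi>\<^sub>2 + cnj d\<eta>\<^sub>2 * d\<xi>\<^sub>1) / 2)
             - \<eta> * wirtinger E \<xi> * ((d\<xi>\<^sub>1 * cnj d\<xi>\<^sub>2 + d\<xi>\<^sub>2 * cnj d\<xi>\<^sub>1) / 2)))"


subsection \<open>Geodesics\<close>

text \<open>
  The Christoffel map of the Levi-Civita connection of a metric in coordinates; the vector is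
  unique because the metric is nondegenerate.
\<close>

definition christoffel ::
  "('a::real_normed_vector \<Rightarrow> 'a \<Rightarrow> 'a \<Rightarrow> real) \<Rightarrow> 'a \<Rightarrow> 'a \<Rightarrow> 'a \<Rightarrow> 'a" where
  "christoffel G p v w = (THE y. \<forall>x. 2 * G p y x =
       frechet_derivative (\<lambda>q. G q w x) (at p) v
     + frechet_derivative (\<lambda>q. G q v x) (at p) w
     - frechet_derivative (\<lambda>q. G q v w) (at p) x)"

definition coord_geodesic ::
  "('a::real_normed_vector \<Rightarrow> 'a \<Rightarrow> 'a \<Rightarrow> real) \<Rightarrow> real set \<Rightarrow> (real \<Rightarrow> 'a) \<Rightarrow> bool" where
  "coord_geodesic G J c \<longleftrightarrow> (\<exists>c' c''. \<forall>s\<in>J.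
     (c has_vector_derivative c' s) (at s) \<and> (c' has_vector_derivative c'' s) (at s) \<and>
     c'' s + christoffel G (c s) (c' s) (c' s) = 0)"

definition geodesic :: "real \<Rightarrow> real set \<Rightarrow> (real \<Rightarrow> oline) \<Rightarrow> bool" where
  "geodesic \<epsilon> I \<gamma> \<longleftrightarrow> open I \<and> connected I \<and> I \<noteq> {} \<and>
     (\<forall>s\<in>I. \<exists>\<kappa>\<in>charts \<epsilon>. \<exists>J c. open J \<and> s \<in> J \<and> J \<subseteq> I \<and>
        (\<forall>r\<in>J. c r \<in> coord_dom \<epsilon> \<and> \<gamma> r = \<kappa> (c r)) \<and>
        coord_geodesic (neutral_metric (conf \<epsilon>)) J c)"

definition maximal_geodesic :: "real \<Rightarrow> real set \<Rightarrow> (real \<Rightarrow> oline) \<Rightarrow> bool" where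
  "maximal_geodesic \<epsilon> I \<gamma> \<longleftrightarrow> geodesic \<epsilon> I \<gamma> \<and>
     (\<forall>I' \<gamma>'. geodesic \<epsilon> I' \<gamma>' \<and> I \<subseteq> I' \<and> (\<forall>s\<in>I. \<gamma>' s = \<gamma> s) \<longrightarrow> I' = I)"


subsection \<open>Consistency of the charts and of the metric\<close>

lemma half_turn_line_point:
  assumes "\<xi> \<noteq> 0"
  shows "half_turn (line_point 1 \<xi> \<eta> r) = line_point 1 (1 / \<xi>) (- \<eta> / \<xi>\<^sup>2) r"
proof -
  define a b D where "a = \<xi>" and "b = cnj \<xi>" and "D = 1 + a * b"
  have nz: "a \<noteq> 0" "b \<noteq> 0"
    using assms by (auto simp: a_def b_def)
  have "D = of_real (1 + (cmod \<xi>)\<^sup>2)"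
    by (simp add: D_def a_def b_def flip: complex_norm_square)
  moreover have "1 + (cmod \<xi>)\<^sup>2 \<noteq> 0"
    by (smt (verit) zero_le_power2)
  ultimately have D: "D \<noteq> 0"
    by (metis of_real_eq_0_iff)
  have cD: "cnj D = D"
    by (simp add: D_def a_def b_def mult.commute)
  have d: "1 + 1 / a * (1 / b) = D / (a * b)"
    using nz by (simp add: D_def field_simps)
  have z: "(2 * (cnj \<eta> - \<eta> * b\<^sup>2) + 2 * b * D * of_real r) / D\<^sup>2
      = (2 * (- \<eta> / a\<^sup>2 - (- cnj \<eta> / b\<^sup>2) * (1 / a)\<^sup>2)
          + 2 * (1 / a) * (D / (a * b)) * of_real r) / (D / (a * b))\<^sup>2"
    using nz D by (simp add: field_simps power2_eq_square)
  have t: "- ((- 2 * (\<eta> * b + cnj \<eta> * a) + (1 - a\<^sup>2 * b\<^sup>2) * of_real r) / D\<^sup>2)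
      = (- 2 * (- \<eta> / a\<^sup>2 * (1 / b) + - cnj \<eta> / b\<^sup>2 * (1 / a))
          + (1 - (1 / a)\<^sup>2 * (1 / b)\<^sup>2) * of_real r) / (D / (a * b))\<^sup>2"
    using nz D by (simp add: field_simps power2_eq_square)
  have cb: "cnj b = a" "cnj a = b"
    by (simp_all add: a_def b_def)
  have north: "half_turn (line_point 1 a \<eta> r) =
      ((2 * (cnj \<eta> - \<eta> * b\<^sup>2) + 2 * b * D * of_real r) / D\<^sup>2,
       Re (- ((- 2 * (\<eta> * b + cnj \<eta> * a) + (1 - a\<^sup>2 * b\<^sup>2) * of_real r) / D\<^sup>2)))"
    by (simp add: half_turn_def line_point_def Let_def cb cD flip: D_def) (simp add: algebra_simps)
  have south: "line_point 1 (1 / a) (- \<eta> / a\<^sup>2) r =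
      ((2 * (- \<eta> / a\<^sup>2 - (- cnj \<eta> / b\<^sup>2) * (1 / a)\<^sup>2)
          + 2 * (1 / a) * (D / (a * b)) * of_real r) / (D / (a * b))\<^sup>2,
       Re ((- 2 * (- \<eta> / a\<^sup>2 * (1 / b) + - cnj \<eta> / b\<^sup>2 * (1 / a))
          + (1 - (1 / a)\<^sup>2 * (1 / b)\<^sup>2) * of_real r) / (D / (a * b))\<^sup>2))"
    by (simp add: line_point_def Let_def cb flip: d) (simp add: algebra_simps)
  show ?thesis
    using north unfolding z t south[symmetric] by (simp only: a_def)
qed

lemma south_chart:
  assumes "\<xi> \<noteq> 0"
  shows "act half_turn (line_of 1 (\<xi>, \<eta>)) = line_of 1 (1 / \<xi>, - \<eta> / \<xi>\<^sup>2)"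
proof -
  have "line_of \<epsilon> (a, b) = map_prod (line_point \<epsilon> a b) (line_point \<epsilon> a b) ` {(r, r'). r \<le> r'}"
    for \<epsilon> a b
    unfolding line_of_def by force
  then show ?thesis
    by (simp add: act_def image_image map_prod_def case_prod_beta half_turn_line_point[OF assms])
qed

lemma neutral_metric_nondegenerate:
  assumes "E (fst p) \<noteq> 0" and G: "\<And>x. neutral_metric E p y x = 0"
  shows "y = 0"
proof -
  obtain \<xi> \<eta> a b where p: "p = (\<xi>, \<eta>)" and y: "y = (a, b)"
    by fastforce
  have E: "E \<xi> \<noteq> 0" using assms(1) p by simp
  have "a = 0"
    using G[of "(0, 1)"] G[of "(0, \<i>)"] E
    by (simp add: p y neutral_metric_def complex_eq_iff)
  moreover from this have "b = 0"
    using G[of "(1, 0)"] G[of "(\<i>, 0)"] E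
    by (simp add: p y neutral_metric_def complex_eq_iff)
  ultimately show ?thesis
    by (simp add: y zero_prod_def)
qed

end

theory Submission
  imports Defs
begin

text \<open>
  Multiplication of the fibre coordinate by \<open>-\<i>\<close> turns the neutral metric into minus the complete lift
  of the metric of \<open>N\<close> to \<open>TN\<close>. Hence in a geodesic \<open>(\<xi>, \<eta>)\<close> the curve \<open>\<xi>\<close> is a geodesic of \<open>N\<close> and
  \<open>- \<i> \<eta>\<close> is a Jacobi field along it. The direction \<open>e\<close> of the line therefore moves on a great circle,
  \<open>e' = \<omega> \<times> e\<close> with a constant \<open>\<omega>\<close> orthogonal to \<open>e\<close>, and the linearisation of \<open>\<omega>\<close> in the direction
  of the Jacobi field is a second constant vector \<open>v\<close>. The line then follows the flow of the
  Killing field \<open>x \<mapsto> \<omega> \<times> x + v\<close> of the ambient space, and \<open>(\<omega>, v)\<close> is determined by any piece of the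
  curve, so that it does not change from one chart to the next. Conversely, each such orbit is a
  geodesic defined for all times; a maximal geodesic is therefore a complete orbit.
\<close>


subsection \<open>The geodesic equation\<close>

text \<open>Why Jacobi fields: the kinetic energy of a complete lift is the first variation of that
  of the base, so varying the fibre coordinate gives the geodesic equation and varying \<xi> gives
  its linearisation. Why the factor -\<i>: the variation of the direction e along -\<i> \<eta> is
  the moment \<open>cross \<epsilon> p e\<close> of the line, p being any of its points
  (\<open>cross_dirn\<close> with p in place of \<open>\<omega>\<close>). A line is thus a unit
  vector over the dual numbers, with parts e and \<open>cross \<epsilon> p e\<close>, and a Killing
  field is a dual vector with parts \<open>\<omega>\<close> and \<open>v\<close>. The result is the
  description of great circles, read over the dual numbers. The two conditions in
  \<open>screw_curve\<close> are the real and the dual part of orthogonality; in the Euclidean case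
  with nonzero \<open>\<omega>\<close> they say that the line meets the screw axis at a right angle.
  The obstacle is gluing: one curve of lines has many generators (a line at rest is also fixed by
  sliding along itself), so a normalisation is needed before the local generators can be
  compared.\<close>

definition nrm :: "real \<Rightarrow> complex \<Rightarrow> real" where
  "nrm \<epsilon> \<xi> = 1 + \<epsilon> * (cmod \<xi>)\<^sup>2"

lemma nrm_pos:
  assumes "\<epsilon> = 1 \<or> \<epsilon> = -1" "(\<xi>, \<eta>) \<in> coord_dom \<epsilon>"
  shows "nrm \<epsilon> \<xi> > 0"
proof -
  consider "\<epsilon> = 1" | "\<epsilon> = -1" "cmod \<xi> < 1"
    using assms by (auto simp: coord_dom_def)
  then show ?thesis
  proof cases
    case 1
    then show ?thesis by (simp add: nrm_def add_pos_nonneg)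
  next
    case 2
    then show ?thesis unfolding nrm_def by (simp add: abs_square_less_1)
  qed
qed

lemma nrm_has_derivative:
  "(nrm \<epsilon> has_derivative (\<lambda>h. 2 * \<epsilon> * (\<xi> \<bullet> h))) (at \<xi>)"
  unfolding nrm_def[abs_def] power2_norm_eq_inner
  by (auto intro!: derivative_eq_intros simp: inner_commute)

lemma wirtinger_conf:
  assumes "nrm \<epsilon> \<xi> \<noteq> 0"
  shows "wirtinger (conf \<epsilon>) \<xi> = - 8 * \<epsilon> * cnj \<xi> / of_real (nrm \<epsilon> \<xi>) ^ 3"
proof -
  have "(conf \<epsilon> has_derivative (\<lambda>h. - 16 * \<epsilon> * (\<xi> \<bullet> h) / nrm \<epsilon> \<xi> ^ 3)) (at \<xi>)"
    unfolding conf_def[abs_def] nrm_def[symmetric]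
    by (rule derivative_eq_intros nrm_has_derivative refl)+
      (use assms in \<open>auto simp: field_simps eval_nat_numeral\<close>)
  then have "frechet_derivative (conf \<epsilon>) (at \<xi>) = (\<lambda>h. - 16 * \<epsilon> * (\<xi> \<bullet> h) / nrm \<epsilon> \<xi> ^ 3)"
    by (rule frechet_derivative_at[symmetric])
  then show ?thesis
    using assms by (simp add: wirtinger_def complex_eq_iff Re_divide_of_real Im_divide_of_real inner_complex_def
      flip: of_real_power)
qed

text \<open>Polarisation leaves the real factor \<open>a \<bullet> a'\<close> in the last term, so
  only the imaginary part of \<open>\<eta> * cnj \<xi>\<close> survives there.\<close>

lemma neutral_metric_eq:
  assumes "nrm \<epsilon> \<xi> \<noteq> 0"
  shows "neutral_metric (conf \<epsilon>) (\<xi>, \<eta>) (a, b) (a', b') =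
    4 * Im (cnj b * a' + cnj b' * a) / nrm \<epsilon> \<xi> ^ 2
    + 16 * \<epsilon> * (a \<bullet> a') * Im (\<eta> * cnj \<xi>) / nrm \<epsilon> \<xi> ^ 3"
  unfolding neutral_metric_def prod.case wirtinger_conf[OF assms] conf_def nrm_def[symmetric]
  by (simp add: Re_divide_of_real Im_divide_of_real inner_complex_def
      flip: of_real_power) (simp add: algebra_simps add_divide_distrib diff_divide_distrib)

lemma neutral_metric_has_derivative:
  assumes "nrm \<epsilon> \<xi> \<noteq> 0"
  shows "((\<lambda>q. neutral_metric (conf \<epsilon>) q (a, b) (a', b')) has_derivative
    (\<lambda>(h, k). - 16 * \<epsilon> * (\<xi> \<bullet> h) * Im (cnj b * a' + cnj b' * a) / nrm \<epsilon> \<xi> ^ 3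
      + 16 * \<epsilon> * (a \<bullet> a') * (Im (k * cnj \<xi> + \<eta> * cnj h) / nrm \<epsilon> \<xi> ^ 3
         - 6 * \<epsilon> * (\<xi> \<bullet> h) * Im (\<eta> * cnj \<xi>) / nrm \<epsilon> \<xi> ^ 4))) (at (\<xi>, \<eta>))"
proof -
  let ?G = "\<lambda>q. 4 * Im (cnj b * a' + cnj b' * a) / nrm \<epsilon> (fst q) ^ 2
    + 16 * \<epsilon> * (a \<bullet> a') * Im (snd q * cnj (fst q)) / nrm \<epsilon> (fst q) ^ 3"
  have nf: "((\<lambda>q. nrm \<epsilon> (fst q)) has_derivative (\<lambda>h. 2 * \<epsilon> * (\<xi> \<bullet> fst h))) (at (\<xi>, \<eta>))"
    by (rule has_derivative_compose[of fst fst]) (auto intro!: nrm_has_derivative derivative_eq_intros)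
  have ni: "((\<lambda>q. inverse (nrm \<epsilon> (fst q))) has_derivative
      (\<lambda>h. - 2 * \<epsilon> * (\<xi> \<bullet> fst h) * (inverse (nrm \<epsilon> \<xi>))\<^sup>2)) (at (\<xi>, \<eta>))"
    using Deriv.has_derivative_inverse[OF _ nf] assms by (simp add: power2_eq_square mult_ac)
  have D: "(?G has_derivative
    (\<lambda>(h, k). - 16 * \<epsilon> * (\<xi> \<bullet> h) * Im (cnj b * a' + cnj b' * a) / nrm \<epsilon> \<xi> ^ 3
      + 16 * \<epsilon> * (a \<bullet> a') * (Im (k * cnj \<xi> + \<eta> * cnj h) / nrm \<epsilon> \<xi> ^ 3
         - 6 * \<epsilon> * (\<xi> \<bullet> h) * Im (\<eta> * cnj \<xi>) / nrm \<epsilon> \<xi> ^ 4))) (at (\<xi>, \<eta>))"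
    unfolding divide_inverse power_inverse[symmetric]
    by (rule derivative_eq_intros ni refl)+
      (simp add: fun_eq_iff case_prod_beta algebra_simps power_numeral_reduce)
  \<comment> \<open>The closed form \<open>?G\<close> of the metric is available where
    \<open>nrm\<close> is nonzero; this set is open, so the derivative carries over.\<close>
  have "continuous_on UNIV (\<lambda>q :: complex \<times> complex. nrm \<epsilon> (fst q))"
    unfolding nrm_def by (intro continuous_intros)
  then have "open ((\<lambda>q :: complex \<times> complex. nrm \<epsilon> (fst q)) -` (- {0}))"
    by (intro open_vimage) auto
  then show ?thesis
    by (rule has_derivative_transform_within_open[OF D])
      (use assms in \<open>auto simp: neutral_metric_eq\<close>)
qed

text \<open>
  The second component is \<open>\<i>\<close> times the linearisation of the first one in the direction \<open>- \<i> (\<eta>, b)\<close>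
  of \<open>(\<xi>, a)\<close>, that is, the Jacobi equation for \<open>- \<i> \<eta>\<close>.
\<close>

definition geodesic_acceleration :: "real \<Rightarrow> complex \<times> complex \<Rightarrow> complex \<times> complex \<Rightarrow> complex \<times> complex" where
  "geodesic_acceleration \<epsilon> = (\<lambda>(\<xi>, \<eta>) (a, b). let E = of_real (\<epsilon> / nrm \<epsilon> \<xi>) in
     (2 * E * cnj \<xi> * a\<^sup>2,
      E * (4 * cnj \<xi> * a * b - 2 * cnj \<eta> * a\<^sup>2)
      - 2 * E\<^sup>2 * cnj \<xi> * a\<^sup>2 * (\<eta> * cnj \<xi> - \<xi> * cnj \<eta>)))"

lemma neutral_metric_diff:
  "neutral_metric E p (y - y') x = neutral_metric E p y x - neutral_metric E p y' x"
  by (simp add: neutral_metric_def case_prod_beta algebra_simps add_divide_distrib diff_divide_distrib)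

text \<open>The explicit vector is checked against the Koszul formula; nondegeneracy makes it the
  value of the definite description.\<close>

lemma christoffel_neutral_metric:
  assumes "nrm \<epsilon> (fst p) \<noteq> 0"
  shows "christoffel (neutral_metric (conf \<epsilon>)) p v v = - geodesic_acceleration \<epsilon> p v"
proof -
  let ?G = "neutral_metric (conf \<epsilon>)"
  obtain \<xi> \<eta> a b where p: "p = (\<xi>, \<eta>)" and v: "v = (a, b)"
    by fastforce
  have nz: "nrm \<epsilon> \<xi> \<noteq> 0" using assms p by simp
  \<comment> \<open>In \<open>n\<close> and real components the Koszul formula becomes an identity
    of polynomials.\<close>
  define n where "n = inverse (nrm \<epsilon> \<xi>)"
  obtain \<xi>1 \<xi>2 \<eta>1 \<eta>2 a1 a2 b1 b2 where c: "\<xi> = Complex \<xi>1 \<xi>2" "\<eta> = Complex \<eta>1 \<eta>2"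
    "a = Complex a1 a2" "b = Complex b1 b2"
    by (metis complex.exhaust)
  have g: "geodesic_acceleration \<epsilon> (\<xi>, \<eta>) (a, b) = (2 * of_real (\<epsilon> * n) * cnj \<xi> * a\<^sup>2,
      of_real (\<epsilon> * n) * (4 * cnj \<xi> * a * b - 2 * cnj \<eta> * a\<^sup>2)
      - 2 * of_real ((\<epsilon> * n)\<^sup>2) * cnj \<xi> * a\<^sup>2 * (\<eta> * cnj \<xi> - \<xi> * cnj \<eta>))"
    by (simp only: geodesic_acceleration_def n_def Let_def prod.case divide_inverse of_real_power)
  have main: "2 * ?G (\<xi>, \<eta>) (- geodesic_acceleration \<epsilon> (\<xi>, \<eta>) (a, b)) (a', b') =
       frechet_derivative (\<lambda>q. ?G q (a, b) (a', b')) (at (\<xi>, \<eta>)) (a, b)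
     + frechet_derivative (\<lambda>q. ?G q (a, b) (a', b')) (at (\<xi>, \<eta>)) (a, b)
     - frechet_derivative (\<lambda>q. ?G q (a, b) (a, b)) (at (\<xi>, \<eta>)) (a', b')" for a' b'
  proof -
    obtain x1 x2 y1 y2 where c': "a' = Complex x1 x2" "b' = Complex y1 y2"
      by (metis complex.exhaust)
    show ?thesis
      unfolding frechet_derivative_at[OF neutral_metric_has_derivative[OF nz], symmetric] g
        uminus_prod_def fst_conv snd_conv neutral_metric_eq[OF nz] prod.case divide_inverse power_inverse[symmetric]
        n_def[symmetric]
      unfolding c c'
      by (simp add: inner_complex_def algebra_simps eval_nat_numeral)
  qed
  show ?thesis
    unfolding christoffel_def
  proof (rule the_equality)
    show "\<forall>x. 2 * ?G p (- geodesic_acceleration \<epsilon> p v) x =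
       frechet_derivative (\<lambda>q. ?G q v x) (at p) v
     + frechet_derivative (\<lambda>q. ?G q v x) (at p) v
     - frechet_derivative (\<lambda>q. ?G q v v) (at p) x"
      using main by (auto simp: p v)
  next
    fix y assume y: "\<forall>x. 2 * ?G p y x =
       frechet_derivative (\<lambda>q. ?G q v x) (at p) v
     + frechet_derivative (\<lambda>q. ?G q v x) (at p) v
     - frechet_derivative (\<lambda>q. ?G q v v) (at p) x"
    have "y - (- geodesic_acceleration \<epsilon> p v) = 0"
    proof (rule neutral_metric_nondegenerate)
      show "conf \<epsilon> (fst p) \<noteq> 0"
        using nz by (simp add: p conf_def nrm_def)
      show "?G p (y - (- geodesic_acceleration \<epsilon> p v)) x = 0" for x
        unfolding neutral_metric_diff using spec[OF y, of x] main[of "fst x" "snd x"] by (simp add: p v)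
    qed
    then show "y = - geodesic_acceleration \<epsilon> p v" by (simp add: eq_neg_iff_add_eq_0)
  qed
qed

lemma coord_geodesic_iff:
  assumes "\<epsilon> = 1 \<or> \<epsilon> = -1" "\<And>s. s \<in> J \<Longrightarrow> c s \<in> coord_dom \<epsilon>"
  shows "coord_geodesic (neutral_metric (conf \<epsilon>)) J c \<longleftrightarrow> (\<exists>c'. \<forall>s\<in>J.
     (c has_vector_derivative c' s) (at s) \<and>
     (c' has_vector_derivative geodesic_acceleration \<epsilon> (c s) (c' s)) (at s))"
proof -
  have *: "christoffel (neutral_metric (conf \<epsilon>)) (c s) v v = - geodesic_acceleration \<epsilon> (c s) v" if "s \<in> J" for s v
    using nrm_pos[OF assms(1), of "fst (c s)" "snd (c s)"] assms(2)[OF that]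
    by (intro christoffel_neutral_metric) simp
  show ?thesis
  proof
    assume "coord_geodesic (neutral_metric (conf \<epsilon>)) J c"
    then obtain c' c'' where c: "\<forall>s\<in>J. (c has_vector_derivative c' s) (at s) \<and>
        (c' has_vector_derivative c'' s) (at s) \<and> c'' s = geodesic_acceleration \<epsilon> (c s) (c' s)"
      unfolding coord_geodesic_def by (auto simp: *)
    show "\<exists>c'. \<forall>s\<in>J. (c has_vector_derivative c' s) (at s) \<and>
        (c' has_vector_derivative geodesic_acceleration \<epsilon> (c s) (c' s)) (at s)"
      by (rule exI[of _ c']) (use c in force)
  next
    assume "\<exists>c'. \<forall>s\<in>J. (c has_vector_derivative c' s) (at s) \<and>
        (c' has_vector_derivative geodesic_acceleration \<epsilon> (c s) (c' s)) (at s)"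
    then obtain c' where "\<forall>s\<in>J. (c has_vector_derivative c' s) (at s) \<and>
        (c' has_vector_derivative geodesic_acceleration \<epsilon> (c s) (c' s)) (at s)" ..
    then show "coord_geodesic (neutral_metric (conf \<epsilon>)) J c"
      unfolding coord_geodesic_def
      by (intro exI[of _ c'] exI[of _ "\<lambda>s. geodesic_acceleration \<epsilon> (c s) (c' s)"]) (simp add: *)
  qed
qed

subsection \<open>Killing fields of the ambient space and their flows\<close>

text \<open>The vector product of 3-space; the factor \<open>\<epsilon>\<close> in the last
  component makes it skew for \<open>flat\<close> in both signatures, so that
  \<open>cross \<epsilon> \<omega> x + v\<close> is a Killing field in \<open>x\<close>.\<close>

definition cross :: "real \<Rightarrow> point \<Rightarrow> point \<Rightarrow> point" where
  "cross \<epsilon> \<omega> x = (- \<i> * (of_real (snd x) * fst \<omega> - of_real (snd \<omega>) * fst x), \<epsilon> * Im (cnj (fst \<omega>) * fst x))"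

lemma bounded_linear_cross: "bounded_linear (cross \<epsilon> \<omega>)"
  unfolding linear_conv_bounded_linear[symmetric]
  by (rule linearI) (simp_all add: cross_def algebra_simps scaleR_conv_of_real)

lemmas linear_cross = bounded_linear.linear[OF bounded_linear_cross]

lemma cross_add: "cross \<epsilon> \<omega> (x + y) = cross \<epsilon> \<omega> x + cross \<epsilon> \<omega> y"
  and cross_diff: "cross \<epsilon> \<omega> (x - y) = cross \<epsilon> \<omega> x - cross \<epsilon> \<omega> y"
  and cross_scaleR: "cross \<epsilon> \<omega> (r *\<^sub>R x) = r *\<^sub>R cross \<epsilon> \<omega> x"
  and cross_zero [simp]: "cross \<epsilon> \<omega> 0 = 0"
  using linear_cross[of \<epsilon> \<omega>]
  by (simp_all add: linear_add linear_diff linear_scale linear_0)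

lemma cross_diff_left: "cross \<epsilon> (\<omega> - \<omega>') x = cross \<epsilon> \<omega> x - cross \<epsilon> \<omega>' x"
  by (simp add: cross_def algebra_simps)

lemma bounded_bilinear_flat: "bounded_bilinear (flat \<epsilon>)"
  unfolding bilinear_conv_bounded_bilinear[symmetric] bilinear_def
  by (intro conjI allI linearI) (simp_all add: flat_def inner_simps algebra_simps)

lemmas flat_add_left = bounded_bilinear.add_left[OF bounded_bilinear_flat]
  and flat_add_right = bounded_bilinear.add_right[OF bounded_bilinear_flat]
  and flat_diff_left = bounded_bilinear.diff_left[OF bounded_bilinear_flat]
  and flat_diff_right = bounded_bilinear.diff_right[OF bounded_bilinear_flat]
  and flat_scaleR_left = bounded_bilinear.scaleR_left[OF bounded_bilinear_flat]
  and flat_scaleR_right = bounded_bilinear.scaleR_right[OF bounded_bilinear_flat]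

lemma flat_commute: "flat \<epsilon> x y = flat \<epsilon> y x"
  by (simp add: flat_def inner_commute)

lemma flat_cross_skew:
  assumes "\<epsilon>\<^sup>2 = 1"
  shows "flat \<epsilon> (cross \<epsilon> \<omega> x) y = - flat \<epsilon> x (cross \<epsilon> \<omega> y)"
proof -
  have ee: "\<epsilon> * (\<epsilon> * q) = q" for q using assms by (simp add: power2_eq_square flip: mult.assoc)
  show ?thesis
    by (simp add: flat_def cross_def inner_complex_def algebra_simps ee)
qed

lemma flat_cross_self:
  assumes "\<epsilon>\<^sup>2 = 1"
  shows "flat \<epsilon> (cross \<epsilon> \<omega> x) x = 0"
  using flat_cross_skew[OF assms, of \<omega> x x] flat_commute by simp

lemma flat_cross_left:
  assumes "\<epsilon>\<^sup>2 = 1"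
  shows "flat \<epsilon> \<omega> (cross \<epsilon> \<omega> x) = 0"
proof -
  have ee: "\<epsilon> * (\<epsilon> * q) = q" for q using assms by (simp add: power2_eq_square flip: mult.assoc)
  show ?thesis
    by (simp add: flat_def cross_def inner_complex_def algebra_simps ee)
qed

text \<open>Cayley-Hamilton: a skew map in dimension three has trace and determinant zero. The
  relation reduces the exponential series to the terms 1, L and the square of L.\<close>

lemma cross_cube:
  assumes "\<epsilon>\<^sup>2 = 1"
  shows "cross \<epsilon> \<omega> (cross \<epsilon> \<omega> (cross \<epsilon> \<omega> x)) = - (\<epsilon> * flat \<epsilon> \<omega> \<omega>) *\<^sub>R cross \<epsilon> \<omega> x"
proof -
  have ee: "\<epsilon> * (\<epsilon> * q) = q" for q using assms by (simp add: power2_eq_square flip: mult.assoc)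
  show ?thesis
    by (simp add: flat_def cross_def inner_complex_def complex_eq_iff algebra_simps ee)
qed

text \<open>A vanishing product makes \<open>\<omega>\<close> parallel to \<open>e\<close>; since
  \<open>e\<close> is not null, orthogonality leaves only zero.\<close>

lemma cross_eq_zero_imp:
  assumes "\<epsilon>\<^sup>2 = 1" "cross \<epsilon> \<omega> e = 0" "flat \<epsilon> \<omega> e = 0" "flat \<epsilon> e e = \<epsilon>"
  shows "\<omega> = 0"
proof -
  obtain a b t where w: "\<omega> = (Complex a b, t)" by (metis complex.exhaust surj_pair)
  obtain x y s where e: "e = (Complex x y, s)" by (metis complex.exhaust surj_pair)
  have h: "\<epsilon> * \<epsilon> = 1" "s * a = t * x" "s * b = t * y" "\<epsilon> * (a * y - b * x) = 0"
      "a * x + b * y + \<epsilon> * (t * s) = 0" "x * x + y * y + \<epsilon> * (s * s) = \<epsilon>"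
    using assms by (simp_all add: w e cross_def flat_def zero_prod_def complex_eq_iff inner_complex_def
       power2_eq_square algebra_simps)
  have "a = 0" "b = 0" "t = 0"
    using h by algebra+
  then show ?thesis by (simp add: w zero_prod_def complex_eq_iff)
qed

text \<open>Gronwall: \<open>\<bar>d\<bar>\<^sup>2 exp (\<plusminus> 2 K s)\<close> is monotone when \<open>K\<close> bounds the norm of \<open>L\<close>.\<close>

lemma linear_ode_zero:
  fixes d :: "real \<Rightarrow> 'a::real_inner"
  assumes L: "bounded_linear L" and J: "connected J" "a \<in> J" "b \<in> J"
    and d: "\<And>s. s \<in> J \<Longrightarrow> (d has_vector_derivative L (d s)) (at s)" and "d a = 0"
  shows "d b = 0"
proof -
  obtain K where K: "\<And>x. norm (L x) \<le> norm x * K"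
    using bounded_linear.bounded[OF L] by blast
  have bnd: "\<bar>d s \<bullet> L (d s)\<bar> \<le> K * (d s \<bullet> d s)" for s
  proof -
    have "\<bar>d s \<bullet> L (d s)\<bar> \<le> norm (d s) * norm (L (d s))"
      by (rule Cauchy_Schwarz_ineq2)
    also have "\<dots> \<le> norm (d s) * (norm (d s) * K)"
      by (intro mult_left_mono K) auto
    finally show ?thesis by (simp add: power2_norm_eq_inner[symmetric] power2_eq_square mult_ac)
  qed
  define f where "f r s = (d s \<bullet> d s) * exp (r * s)" for r s
  have f: "(f r has_real_derivative (2 * (d s \<bullet> L (d s)) + r * (d s \<bullet> d s)) * exp (r * s)) (at s)"
    if "s \<in> J" for r s
  proof -
    have "((\<lambda>s. d s \<bullet> d s) has_real_derivative 2 * (d s \<bullet> L (d s))) (at s)"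
      using bounded_bilinear.has_vector_derivative[OF bounded_bilinear_inner d d, OF that that]
      by (simp add: has_real_derivative_iff_has_vector_derivative inner_commute)
    then show ?thesis
      unfolding f_def by (auto intro!: derivative_eq_intros simp: algebra_simps)
  qed
  have sub: "{min a b..max a b} \<subseteq> J"
    using connected_contains_Icc[OF J(1)] J(2,3) by (auto simp: min_def max_def)
  have "d b \<bullet> d b \<le> 0"
  proof (cases "a \<le> b")
    case True
    have "f (- 2 * K) a \<ge> f (- 2 * K) b"
    proof (rule DERIV_nonpos_imp_nonincreasing[OF True])
      fix x assume "a \<le> x" "x \<le> b"
      then have x: "x \<in> J" using sub True by auto
      have "2 * (d x \<bullet> L (d x)) + - 2 * K * (d x \<bullet> d x) \<le> 0"
        using bnd[of x] by linarith
      then have "(2 * (d x \<bullet> L (d x)) + - 2 * K * (d x \<bullet> d x)) * exp (- 2 * K * x) \<le> 0"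
        by (simp add: mult_nonpos_nonneg)
      then show "\<exists>y. (f (- 2 * K) has_real_derivative y) (at x) \<and> y \<le> 0"
        using f[OF x, of "- 2 * K"] by blast
    qed
    then show ?thesis using \<open>d a = 0\<close> by (simp add: f_def mult_le_0_iff)
  next
    case False
    then have ba: "b \<le> a" by simp
    have "f (2 * K) b \<le> f (2 * K) a"
    proof (rule DERIV_nonneg_imp_nondecreasing[OF ba])
      fix x assume "b \<le> x" "x \<le> a"
      then have x: "x \<in> J" using sub ba by auto
      have "2 * (d x \<bullet> L (d x)) + 2 * K * (d x \<bullet> d x) \<ge> 0"
        using bnd[of x] by linarith
      then have "(2 * (d x \<bullet> L (d x)) + 2 * K * (d x \<bullet> d x)) * exp (2 * K * x) \<ge> 0"
        by simp
      then show "\<exists>y. (f (2 * K) has_real_derivative y) (at x) \<and> 0 \<le> y"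
        using f[OF x, of "2 * K"] by blast
    qed
    then show ?thesis using \<open>d a = 0\<close> by (simp add: f_def mult_le_0_iff)
  qed
  then show ?thesis by (metis inner_ge_zero inner_eq_zero_iff order_antisym)
qed

lemma has_vector_derivative_zero_connected:
  fixes f :: "real \<Rightarrow> 'a::real_inner"
  assumes "connected J" "a \<in> J" "b \<in> J" "\<And>s. s \<in> J \<Longrightarrow> (f has_vector_derivative 0) (at s)"
  shows "f a = f b"
proof -
  have "f b - f a = 0"
    by (rule linear_ode_zero[where L = "\<lambda>_. 0" and J = J and a = a and d = "\<lambda>s. f s - f a"])
      (use assms in \<open>auto intro!: derivative_eq_intros\<close>)
  then show ?thesis by simp
qed

lemma oriented_line_image:
  "oriented_line q w = (\<lambda>(r, r'). (q + r *\<^sub>R w, q + r' *\<^sub>R w)) ` {(r, r'). r \<le> r'}"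
  unfolding oriented_line_def by force

text \<open>If \<open>L (L (L x)) = - k *\<^sub>R L x\<close>, the exponential of s L is
  \<open>1 + S L + C L\<^sup>2\<close>, and \<open>T\<close> enters through its time integral. The
  sign of \<open>k\<close> decides between trigonometric, polynomial and hyperbolic functions;
  Lorentzian \<open>\<omega>\<close> produce all three.\<close>

lemma harmonic_functions_exist:
  fixes k :: real
  shows "\<exists>S C T. S 0 = 0 \<and> C 0 = 0 \<and> T 0 = 0 \<and>
    (\<forall>s. (S has_real_derivative 1 - k * C s) (at s) \<and> (C has_real_derivative S s) (at s) \<and>
         (T has_real_derivative C s) (at s))"
proof -
  consider "k = 0" | q where "q > 0" "k = q\<^sup>2" | q where "q > 0" "k = - q\<^sup>2"
    by (metis neg_0_less_iff_less linorder_neqE_linordered_idom minus_minus real_sqrt_gt_zero real_sqrt_pow2 less_imp_le)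
  then show ?thesis
  proof cases
    case 1
    then show ?thesis
      by (intro exI[of _ "\<lambda>s. s"] exI[of _ "\<lambda>s. s\<^sup>2 / 2"] exI[of _ "\<lambda>s. s ^ 3 / 6"])
        (auto intro!: derivative_eq_intros simp: power2_eq_square)
  next
    case 2
    then show ?thesis
      by (intro exI[of _ "\<lambda>s. sin (q * s) / q"] exI[of _ "\<lambda>s. (1 - cos (q * s)) / q\<^sup>2"]
          exI[of _ "\<lambda>s. (s - sin (q * s) / q) / q\<^sup>2"])
        (auto intro!: derivative_eq_intros simp: power2_eq_square)
  next
    case 3
    then show ?thesis
      by (intro exI[of _ "\<lambda>s. sinh (q * s) / q"] exI[of _ "\<lambda>s. (cosh (q * s) - 1) / q\<^sup>2"]
          exI[of _ "\<lambda>s. (sinh (q * s) / q - s) / q\<^sup>2"])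
        (auto intro!: derivative_eq_intros simp: power2_eq_square)
  qed
qed

section \<open>The flow of an affine Killing field\<close>

definition is_flow :: "real \<Rightarrow> point \<Rightarrow> point \<Rightarrow> (real \<Rightarrow> point \<Rightarrow> point) \<Rightarrow> bool" where
  "is_flow \<epsilon> \<omega> v \<phi> \<longleftrightarrow> (\<forall>x. \<phi> 0 x = x \<and>
    (\<forall>s. ((\<lambda>s. \<phi> s x) has_vector_derivative cross \<epsilon> \<omega> (\<phi> s x) + v) (at s)))"

lemma is_flow_exists:
  assumes "\<epsilon>\<^sup>2 = 1"
  shows "\<exists>\<phi>. is_flow \<epsilon> \<omega> v \<phi>"
proof -
  define k where "k = \<epsilon> * flat \<epsilon> \<omega> \<omega>"
  obtain S C T where z: "S 0 = 0" "C 0 = 0" "T 0 = 0" and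
    d: "\<And>s. (S has_real_derivative 1 - k * C s) (at s)" "\<And>s. (C has_real_derivative S s) (at s)"
       "\<And>s. (T has_real_derivative C s) (at s)"
    using harmonic_functions_exist[of k] by metis
  let ?L = "cross \<epsilon> \<omega>"
  \<comment> \<open>Variation of constants: the terms in \<open>x\<close> are exp(s L) x, those in
    \<open>v\<close> are the integral of exp(u L) v over u from 0 to s.\<close>
  define \<phi> where "\<phi> s x = x + S s *\<^sub>R ?L x + C s *\<^sub>R ?L (?L x) + s *\<^sub>R v + C s *\<^sub>R ?L v + T s *\<^sub>R ?L (?L v)" for s x
  have cube: "?L (?L (?L x)) = - k *\<^sub>R ?L x" for x
    using cross_cube[OF assms] by (simp add: k_def)
  have "((\<lambda>s. \<phi> s x) has_vector_derivative ?L (\<phi> s x) + v) (at s)" for s x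
  proof -
    have "((\<lambda>s. \<phi> s x) has_vector_derivative ((1 - k * C s) *\<^sub>R ?L x + S s *\<^sub>R ?L (?L x) + v
       + S s *\<^sub>R ?L v + C s *\<^sub>R ?L (?L v))) (at s)"
      unfolding \<phi>_def by (auto intro!: derivative_eq_intros d)
    moreover have L: "?L (\<phi> s x) = ?L x + S s *\<^sub>R ?L (?L x) - (k * C s) *\<^sub>R ?L x + s *\<^sub>R ?L v
       + C s *\<^sub>R ?L (?L v) - (k * T s) *\<^sub>R ?L v"
      by (simp add: \<phi>_def cross_add cross_scaleR cube mult.commute)
    \<comment> \<open>Both sides vanish at 0 and have the derivative
      \<open>1 - k * C s\<close>.\<close>
    moreover have "s - k * T s = S s"
    proof -
      have "((\<lambda>s. s - k * T s - S s) has_vector_derivative 0) (at u)" for u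
        by (auto intro!: derivative_eq_intros d[THEN DERIV_cmult] d
            simp: has_real_derivative_iff_has_vector_derivative[symmetric])
      from has_vector_derivative_zero_connected[OF connected_UNIV _ _ this, of s 0]
      show ?thesis by (simp add: z)
    qed
    then have T: "S s *\<^sub>R ?L v = s *\<^sub>R ?L v - (k * T s) *\<^sub>R ?L v"
      by (metis scaleR_diff_left)
    have "(1 - k * C s) *\<^sub>R ?L x + S s *\<^sub>R ?L (?L x) + v + S s *\<^sub>R ?L v + C s *\<^sub>R ?L (?L v)
      = ?L (\<phi> s x) + v"
      unfolding L T by (simp add: scaleR_diff_left)
    ultimately show ?thesis by simp
  qed
  moreover have "\<phi> 0 x = x" for x by (simp add: \<phi>_def z)
  ultimately show ?thesis unfolding is_flow_def by blast
qed

text \<open>The flow exists by \<open>is_flow_exists\<close> when \<open>\<epsilon>\<^sup>2 = 1\<close>, and is unique by \<open>linear_ode_zero\<close>.\<close>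

definition flow :: "real \<Rightarrow> point \<Rightarrow> point \<Rightarrow> real \<Rightarrow> point \<Rightarrow> point" where
  "flow \<epsilon> \<omega> v = (SOME \<phi>. is_flow \<epsilon> \<omega> v \<phi>)"

lemma flat_has_vector_derivative:
  assumes "(e has_vector_derivative e') (at s)" "(f has_vector_derivative f') (at s)"
  shows "((\<lambda>s. flat \<epsilon> (e s) (f s)) has_vector_derivative (flat \<epsilon> (e s) f' + flat \<epsilon> e' (f s))) (at s)"
  using bounded_bilinear.has_vector_derivative[OF bounded_bilinear_flat assms] .

context
  fixes \<epsilon> :: real
  assumes sq: "\<epsilon>\<^sup>2 = 1"
begin

lemma is_flow_flow: "is_flow \<epsilon> \<omega> v (flow \<epsilon> \<omega> v)"
  unfolding flow_def using someI_ex[OF is_flow_exists[OF sq]] .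

lemma flow_0 [simp]: "flow \<epsilon> \<omega> v 0 x = x"
  using is_flow_flow unfolding is_flow_def by blast

lemma flow_deriv:
  "((\<lambda>s. flow \<epsilon> \<omega> v s x) has_vector_derivative cross \<epsilon> \<omega> (flow \<epsilon> \<omega> v s x) + v) (at s)"
  using is_flow_flow unfolding is_flow_def by blast

lemma flow_deriv_shift:
  "((\<lambda>s. flow \<epsilon> \<omega> v (s - a) x) has_vector_derivative cross \<epsilon> \<omega> (flow \<epsilon> \<omega> v (s - a) x) + v) (at s)"
proof -
  have "((\<lambda>s. s - a) has_real_derivative 1) (at s)"
    by (auto intro!: derivative_eq_intros)
  from vector_diff_chain_at[OF this[unfolded has_real_derivative_iff_has_vector_derivative] flow_deriv]
  show ?thesis by (simp add: o_def)
qed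

text \<open>The group law and the affine form of the flow come from here: the other side of each
  equation is exhibited as a solution of the same initial value problem.\<close>

lemma flow_unique:
  assumes "connected J" "a \<in> J" "b \<in> J"
    and p: "\<And>s. s \<in> J \<Longrightarrow> (p has_vector_derivative cross \<epsilon> \<omega> (p s) + v) (at s)"
  shows "p b = flow \<epsilon> \<omega> v (b - a) (p a)"
proof -
  have "p b - flow \<epsilon> \<omega> v (b - a) (p a) = 0"
    by (rule linear_ode_zero[OF bounded_linear_cross, where J = J and a = a and b = b and \<epsilon>1 = \<epsilon> and \<omega>1 = \<omega>
          and d = "\<lambda>s. p s - flow \<epsilon> \<omega> v (s - a) (p a)"])
      (use assms(1-3) in \<open>auto intro!: derivative_eq_intros p flow_deriv_shift simp: cross_diff\<close>)
  then show ?thesis by simp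
qed

lemma flow_eqI:
  assumes "\<And>s. (p has_vector_derivative cross \<epsilon> \<omega> (p s) + v) (at s)"
  shows "p s = flow \<epsilon> \<omega> v s (p 0)"
  using flow_unique[of UNIV 0 s p \<omega> v] assms by simp

lemma flow_add: "flow \<epsilon> \<omega> v (s + t) x = flow \<epsilon> \<omega> v s (flow \<epsilon> \<omega> v t x)"
  using flow_eqI[OF flow_deriv_shift[of \<omega> v "- t" x], of s] by simp

lemma flow_minus_cancel [simp]: "flow \<epsilon> \<omega> v s (flow \<epsilon> \<omega> v (- s) x) = x"
  "flow \<epsilon> \<omega> v (- s) (flow \<epsilon> \<omega> v s x) = x"
  using flow_add[of \<omega> v s "- s" x] flow_add[of \<omega> v "- s" s x] by simp_all

lemma flow_affine: "flow \<epsilon> \<omega> v s (x + r *\<^sub>R y) = flow \<epsilon> \<omega> v s x + r *\<^sub>R flow \<epsilon> \<omega> 0 s y"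
proof -
  have "((\<lambda>s. flow \<epsilon> \<omega> v s x + r *\<^sub>R flow \<epsilon> \<omega> 0 s y) has_vector_derivative
    cross \<epsilon> \<omega> (flow \<epsilon> \<omega> v s x + r *\<^sub>R flow \<epsilon> \<omega> 0 s y) + v) (at s)" for s
    using has_vector_derivative_add[OF flow_deriv[of \<omega> v x s]
      bounded_linear.has_vector_derivative[OF bounded_linear_scaleR_right flow_deriv[of \<omega> 0 y s]], of r]
    by (simp add: cross_add cross_scaleR add_ac)
  from flow_eqI[OF this, of s] show ?thesis by simp
qed

lemma flow_linear_zero [simp]: "flow \<epsilon> \<omega> 0 s 0 = 0"
  using flow_eqI[of "\<lambda>_. 0" \<omega> 0 s] by simp

lemma linear_flow: "linear (flow \<epsilon> \<omega> 0 s)"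
  using flow_affine[of \<omega> 0 s _ 1] flow_affine[of \<omega> 0 s 0]
  by (intro linearI) simp_all

lemma flow_eq_linear_plus: "flow \<epsilon> \<omega> v s x = flow \<epsilon> \<omega> 0 s x + flow \<epsilon> \<omega> v s 0"
  using flow_affine[of \<omega> v s 0 1 x] by simp

lemma flat_flow: "flat \<epsilon> (flow \<epsilon> \<omega> 0 s x) (flow \<epsilon> \<omega> 0 s y) = flat \<epsilon> x y"
proof -
  have "((\<lambda>s. flat \<epsilon> (flow \<epsilon> \<omega> 0 s x) (flow \<epsilon> \<omega> 0 s y)) has_vector_derivative 0) (at u)" for u
    using flat_has_vector_derivative[OF flow_deriv[of \<omega> 0 x u] flow_deriv[of \<omega> 0 y u], of \<epsilon>]
    by (simp add: flat_cross_skew[OF sq])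
  from has_vector_derivative_zero_connected[OF connected_UNIV _ _ this, of s 0]
  show ?thesis by simp
qed

lemma one_parameter_subgroup_flow: "one_parameter_subgroup \<epsilon> (flow \<epsilon> \<omega> v)"
  unfolding one_parameter_subgroup_def
proof (intro conjI allI)
  show "flow \<epsilon> \<omega> v s \<in> isometries \<epsilon>" for s
    unfolding isometries_def mem_Collect_eq
    by (rule exI[of _ "flow \<epsilon> \<omega> 0 s"], rule exI[of _ "flow \<epsilon> \<omega> v s 0"])
      (intro conjI ext flow_eq_linear_plus linear_flow allI flat_flow)
  show "flow \<epsilon> \<omega> v 0 = id" "flow \<epsilon> \<omega> v (s + t) = flow \<epsilon> \<omega> v s \<circ> flow \<epsilon> \<omega> v t" for s t
    by (auto simp: fun_eq_iff flow_add)
  show "continuous_on UNIV (\<lambda>s. flow \<epsilon> \<omega> v s x)" for x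
    by (rule continuous_on_vector_derivative, rule has_vector_derivative_at_within[OF flow_deriv])
qed

lemma act_flow_oriented_line:
  "act (flow \<epsilon> \<omega> v s) (oriented_line p e) = oriented_line (flow \<epsilon> \<omega> v s p) (flow \<epsilon> \<omega> 0 s e)"
  by (simp add: oriented_line_image act_def image_image map_prod_def case_prod_beta flow_affine)

end

subsection \<open>Lines moved by a Killing field\<close>

lemma oriented_line_shift: "oriented_line (p + r *\<^sub>R e) e = oriented_line p e"
proof -
  have sub: "oriented_line (p + r *\<^sub>R e) e \<subseteq> oriented_line p e" for p r
    unfolding oriented_line_def
    by clarify (metis (no_types) add.assoc add_left_mono scaleR_left_distrib)
  from sub[of p r] sub[of "p + r *\<^sub>R e" "- r"] show ?thesis by auto
qed

text \<open>The common points make \<open>e\<close> a multiple of \<open>f\<close>; the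
  normalisation restricts the factor to 1 or -1, and the order excludes -1.\<close>

lemma oriented_line_eq_imp:
  assumes "oriented_line p e = oriented_line q f" "flat \<epsilon> e e = \<epsilon>" "flat \<epsilon> f f = \<epsilon>" "\<epsilon> \<noteq> 0"
  shows "e = f" "\<exists>r. q = p + r *\<^sub>R e"
proof -
  have "(p + 0 *\<^sub>R e, p + 1 *\<^sub>R e) \<in> oriented_line p e"
    unfolding oriented_line_def using zero_le_one by blast
  then obtain r r' where r: "r \<le> r'" "p = q + r *\<^sub>R f" "p + e = q + r' *\<^sub>R f"
    unfolding assms(1) by (auto simp: oriented_line_def)
  then have e: "e = (r' - r) *\<^sub>R f"
    by (simp add: scaleR_diff_left) (metis add_diff_cancel_left' add_diff_eq diff_add_eq)
  then have "\<epsilon> = (r' - r)\<^sup>2 * \<epsilon>"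
    using assms(2,3) by (simp add: flat_scaleR_left flat_scaleR_right power2_eq_square)
  then have "(r' - r)\<^sup>2 = 1" using assms(4) by simp
  then have "r' - r = 1" using r(1) by (simp add: power2_eq_1_iff)
  then show "e = f" using e by simp
  then have "q = p + (- r) *\<^sub>R e" using r(2) by simp
  then show "\<exists>r. q = p + r *\<^sub>R e" ..
qed

text \<open>
  The two conditions relating \<open>(\<omega>, v)\<close> to the line single out the orbits that are geodesics; they also make
  \<open>(\<omega>, v)\<close> unique. The second one does not depend on the point \<open>p s\<close> chosen on the line.
\<close>

definition screw_curve :: "real \<Rightarrow> point \<Rightarrow> point \<Rightarrow> real set \<Rightarrow> (real \<Rightarrow> oline) \<Rightarrow> bool" where
  "screw_curve \<epsilon> \<omega> v J \<gamma> \<longleftrightarrow> (\<exists>e p. \<forall>s\<in>J.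
     (e has_vector_derivative cross \<epsilon> \<omega> (e s)) (at s) \<and>
     (p has_vector_derivative cross \<epsilon> \<omega> (p s) + v) (at s) \<and>
     flat \<epsilon> (e s) (e s) = \<epsilon> \<and> (\<epsilon> = -1 \<longrightarrow> snd (e s) > 0) \<and>
     flat \<epsilon> \<omega> (e s) = 0 \<and> flat \<epsilon> v (e s) = flat \<epsilon> (cross \<epsilon> \<omega> (e s)) (p s) \<and>
     \<gamma> s = oriented_line (p s) (e s))"

lemma screw_curve_subset: "screw_curve \<epsilon> \<omega> v J \<gamma> \<Longrightarrow> K \<subseteq> J \<Longrightarrow> screw_curve \<epsilon> \<omega> v K \<gamma>"
  unfolding screw_curve_def by (meson subsetD)

context
  fixes \<epsilon> :: real
  assumes sq: "\<epsilon>\<^sup>2 = 1"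
begin

lemma eps_nz: "\<epsilon> \<noteq> 0"
  using sq by auto

text \<open>All three come from skewness of \<open>cross\<close>. The last quantity is the
  difference of the two sides of the second condition in \<open>screw_curve\<close>, so both
  conditions propagate from a single time.\<close>

lemma screw_invariants:
  assumes "connected J" "a \<in> J" "b \<in> J"
    and e: "\<And>s. s \<in> J \<Longrightarrow> (e has_vector_derivative cross \<epsilon> \<omega> (e s)) (at s)"
    and p: "\<And>s. s \<in> J \<Longrightarrow> (p has_vector_derivative cross \<epsilon> \<omega> (p s) + v) (at s)"
  shows "flat \<epsilon> (e a) (e a) = flat \<epsilon> (e b) (e b)"
    and "flat \<epsilon> \<omega> (e a) = flat \<epsilon> \<omega> (e b)"
    and "flat \<epsilon> v (e a) - flat \<epsilon> (cross \<epsilon> \<omega> (e a)) (p a) = flat \<epsilon> v (e b) - flat \<epsilon> (cross \<epsilon> \<omega> (e b)) (p b)"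
proof -
  have e': "((\<lambda>s. cross \<epsilon> \<omega> (e s)) has_vector_derivative cross \<epsilon> \<omega> (cross \<epsilon> \<omega> (e s))) (at s)" if "s \<in> J" for s
    using bounded_linear.has_vector_derivative[OF bounded_linear_cross e[OF that]] .
  note const = has_vector_derivative_zero_connected[OF assms(1-3)]
  show "flat \<epsilon> (e a) (e a) = flat \<epsilon> (e b) (e b)"
    by (rule const[of "\<lambda>s. flat \<epsilon> (e s) (e s)"], rule has_vector_derivative_eq_rhs,
        rule flat_has_vector_derivative[OF e e])
      (auto simp: flat_cross_skew[OF sq])
  show "flat \<epsilon> \<omega> (e a) = flat \<epsilon> \<omega> (e b)"
    by (rule const[of "\<lambda>s. flat \<epsilon> \<omega> (e s)"], rule has_vector_derivative_eq_rhs,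
        rule flat_has_vector_derivative[OF has_vector_derivative_const e])
      (auto simp: flat_cross_left[OF sq] bounded_bilinear.zero_left[OF bounded_bilinear_flat])
  show "flat \<epsilon> v (e a) - flat \<epsilon> (cross \<epsilon> \<omega> (e a)) (p a) = flat \<epsilon> v (e b) - flat \<epsilon> (cross \<epsilon> \<omega> (e b)) (p b)"
    by (rule const[of "\<lambda>s. flat \<epsilon> v (e s) - flat \<epsilon> (cross \<epsilon> \<omega> (e s)) (p s)"],
        rule has_vector_derivative_eq_rhs, rule has_vector_derivative_diff,
        rule flat_has_vector_derivative[OF has_vector_derivative_const e], assumption,
        rule flat_has_vector_derivative[OF e' p])
      (auto simp: flat_cross_skew[OF sq] flat_add_right flat_commute[of \<epsilon> v]
         bounded_bilinear.zero_left[OF bounded_bilinear_flat])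
qed

text \<open>Both descriptions share the direction \<open>e\<close>, so
  \<open>\<omega> - \<omega>'\<close> is orthogonal to \<open>e\<close> and annihilates it. The base
  points may still slide against each other along the lines; the second condition makes the sliding
  velocity vanish, and comparing velocities then gives \<open>v = v'\<close>.\<close>

lemma screw_curve_unique:
  assumes "screw_curve \<epsilon> \<omega> v J \<gamma>" "screw_curve \<epsilon> \<omega>' v' J \<gamma>" "open J" "s \<in> J"
  shows "\<omega> = \<omega>'" "v = v'"
proof -
  obtain e p where ep: "\<And>s. s \<in> J \<Longrightarrow>
     (e has_vector_derivative cross \<epsilon> \<omega> (e s)) (at s) \<and>
     (p has_vector_derivative cross \<epsilon> \<omega> (p s) + v) (at s) \<and>
     flat \<epsilon> (e s) (e s) = \<epsilon> \<and>
     flat \<epsilon> \<omega> (e s) = 0 \<and> flat \<epsilon> v (e s) = flat \<epsilon> (cross \<epsilon> \<omega> (e s)) (p s) \<and>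
     \<gamma> s = oriented_line (p s) (e s)"
    using assms(1) unfolding screw_curve_def by blast
  obtain f q where fq: "\<And>s. s \<in> J \<Longrightarrow>
     (f has_vector_derivative cross \<epsilon> \<omega>' (f s)) (at s) \<and>
     (q has_vector_derivative cross \<epsilon> \<omega>' (q s) + v') (at s) \<and>
     flat \<epsilon> (f s) (f s) = \<epsilon> \<and>
     flat \<epsilon> \<omega>' (f s) = 0 \<and> flat \<epsilon> v' (f s) = flat \<epsilon> (cross \<epsilon> \<omega>' (f s)) (q s) \<and>
     \<gamma> s = oriented_line (q s) (f s)"
    using assms(2) unfolding screw_curve_def by blast
  have ef: "e u = f u" and ex: "\<exists>r. q u = p u + r *\<^sub>R e u" if "u \<in> J" for u
    using oriented_line_eq_imp[of "p u" "e u" "q u" "f u" \<epsilon>] ep[OF that] fq[OF that] eps_nz by auto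
  note fes = ef[OF assms(4), symmetric]
  have e1: "(e has_vector_derivative cross \<epsilon> \<omega> (e s)) (at s)" "flat \<epsilon> \<omega> (e s) = 0"
      "flat \<epsilon> (e s) (e s) = \<epsilon>" "flat \<epsilon> v (e s) = flat \<epsilon> (cross \<epsilon> \<omega> (e s)) (p s)"
    and p1: "(p has_vector_derivative cross \<epsilon> \<omega> (p s) + v) (at s)"
    using ep[OF assms(4)] by auto
  have f1: "(f has_vector_derivative cross \<epsilon> \<omega>' (e s)) (at s)" "flat \<epsilon> \<omega>' (e s) = 0"
      "flat \<epsilon> v' (e s) = flat \<epsilon> (cross \<epsilon> \<omega>' (e s)) (q s)"
    and q1: "(q has_vector_derivative cross \<epsilon> \<omega>' (q s) + v') (at s)"
    using fq[OF assms(4)] unfolding fes by auto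
  have "(e has_vector_derivative cross \<epsilon> \<omega>' (e s)) (at s)"
    by (rule has_vector_derivative_transform_within_open[OF f1(1) assms(3,4)]) (simp add: ef)
  then have "cross \<epsilon> \<omega> (e s) = cross \<epsilon> \<omega>' (e s)"
    using e1(1) vector_derivative_unique_at by blast
  then have "\<omega> - \<omega>' = 0"
    using cross_eq_zero_imp[OF sq _ _ e1(3), of "\<omega> - \<omega>'"] e1(2) f1(2)
    by (simp add: cross_diff_left flat_diff_left)
  then show \<omega>: "\<omega> = \<omega>'" by simp
  \<comment> \<open>Equality of the lines yields some shift at each time without any regularity;
    this formula for it is differentiable.\<close>
  define r where "r u = \<epsilon> * flat \<epsilon> (q u - p u) (e u)" for u
  have q: "q u - p u = r u *\<^sub>R e u" if u: "u \<in> J" for u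
  proof -
    obtain r' where r': "q u = p u + r' *\<^sub>R e u" using ex[OF u] ..
    have "flat \<epsilon> (e u) (e u) = \<epsilon>" using ep[OF u] by blast
    then show ?thesis using sq by (simp add: r_def r' flat_scaleR_left mult.left_commute power2_eq_square)
  qed
  have qd: "((\<lambda>u. q u - p u) has_vector_derivative (cross \<epsilon> \<omega> (q s - p s) + (v' - v))) (at s)"
    using has_vector_derivative_diff[OF q1 p1] by (simp add: \<omega> cross_diff algebra_simps)
  have "flat \<epsilon> (v' - v) (e s) = flat \<epsilon> (cross \<epsilon> \<omega> (e s)) (q s - p s)"
    using f1(3) e1(4) by (simp add: \<omega> flat_diff_left flat_diff_right)
  then have v0: "flat \<epsilon> (v' - v) (e s) = 0"
    by (simp add: q[OF assms(4)] flat_scaleR_right flat_cross_self[OF sq])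
  have "(r has_vector_derivative 0) (at s)"
    using has_vector_derivative_mult_right[OF flat_has_vector_derivative[OF qd e1(1), of \<epsilon>], of \<epsilon>] v0
    by (simp add: r_def[abs_def] flat_add_left flat_cross_skew[OF sq])
  then have "((\<lambda>u. r u *\<^sub>R e u) has_vector_derivative r s *\<^sub>R cross \<epsilon> \<omega> (e s)) (at s)"
    using has_vector_derivative_scaleR[of r 0 s UNIV e "cross \<epsilon> \<omega> (e s)"] e1(1)
    by (simp add: has_real_derivative_iff_has_vector_derivative)
  then have "((\<lambda>u. q u - p u) has_vector_derivative r s *\<^sub>R cross \<epsilon> \<omega> (e s)) (at s)"
    by (rule has_vector_derivative_transform_within_open) (use assms(3,4) q in auto)
  then have "cross \<epsilon> \<omega> (q s - p s) + (v' - v) = r s *\<^sub>R cross \<epsilon> \<omega> (e s)"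
    using qd vector_derivative_unique_at by blast
  then show "v = v'"
    by (simp add: q[OF assms(4)] cross_scaleR)
qed

text \<open>Where two of the chosen neighbourhoods overlap, \<open>screw_curve_unique\<close>
  identifies their pairs; the choice is therefore locally constant on the connected set
  \<open>I\<close>.\<close>

lemma screw_curve_global:
  assumes "connected I"
    and loc: "\<And>s. s \<in> I \<Longrightarrow> \<exists>\<omega> v J. open J \<and> s \<in> J \<and> connected J \<and> screw_curve \<epsilon> \<omega> v J \<gamma>"
  shows "\<exists>\<omega> v. \<forall>s\<in>I. \<exists>J. open J \<and> s \<in> J \<and> connected J \<and> screw_curve \<epsilon> \<omega> v J \<gamma>"
proof -
  obtain W V N where N: "\<And>s. s \<in> I \<Longrightarrow> open (N s) \<and> s \<in> N s \<and> connected (N s) \<and> screw_curve \<epsilon> (W s) (V s) (N s) \<gamma>"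
    using loc by metis
  have ev: "eventually (\<lambda>b. (W a, V a) = (W b, V b)) (at a within I)" if a: "a \<in> I" for a
    unfolding eventually_at_topological
  proof (intro exI[of _ "N a"] conjI ballI impI)
    fix b assume b: "b \<in> N a" "b \<noteq> a" "b \<in> I"
    have "screw_curve \<epsilon> (W a) (V a) (N a \<inter> N b) \<gamma>" "screw_curve \<epsilon> (W b) (V b) (N a \<inter> N b) \<gamma>"
      using N[OF a] N[OF b(3)] screw_curve_subset by blast+
    from screw_curve_unique[OF this, of b] show "(W a, V a) = (W b, V b)"
      using N[OF a] N[OF b(3)] b by auto
  qed (use N[OF a] in auto)
  have eq: "(W a, V a) = (W b, V b)" if "a \<in> I" "b \<in> I" for a b
    using connected_local_const[OF assms(1) that, of "\<lambda>s. (W s, V s)"] ev by blast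
  show ?thesis
  proof (cases "I = {}")
    case False
    then obtain a where a: "a \<in> I" by blast
    have "\<exists>J. open J \<and> s \<in> J \<and> connected J \<and> screw_curve \<epsilon> (W a) (V a) J \<gamma>" if "s \<in> I" for s
      using N[OF that] eq[OF a that] by (intro exI[of _ "N s"]) auto
    then show ?thesis by blast
  qed simp
qed

text \<open>A vector of negative square cannot have last coordinate 0, and the flow preserves the
  square; along a continuous orbit the sign cannot change.\<close>

lemma flow_future:
  assumes "flat \<epsilon> e e = \<epsilon>" "\<epsilon> = -1" "snd e > 0"
  shows "snd (flow \<epsilon> \<omega> 0 s e) > 0"
proof (rule ccontr)
  let ?f = "\<lambda>u. snd (flow \<epsilon> \<omega> 0 u e)"
  assume "\<not> ?f s > 0"
  have nz: "?f u \<noteq> 0" for u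
  proof
    assume "?f u = 0"
    then have "flat \<epsilon> (flow \<epsilon> \<omega> 0 u e) (flow \<epsilon> \<omega> 0 u e) \<ge> 0"
      by (simp add: flat_def)
    then show False using assms unfolding flat_flow[OF sq] by simp
  qed
  have "continuous_on UNIV (\<lambda>u. flow \<epsilon> \<omega> 0 u e)"
    using one_parameter_subgroup_flow[OF sq, of \<omega> 0] unfolding one_parameter_subgroup_def by blast
  then have cont: "continuous_on UNIV ?f" by (intro continuous_intros)
  have "connected (range ?f)" by (rule connected_continuous_image[OF cont connected_UNIV])
  moreover have "?f 0 \<in> range ?f" "?f s \<in> range ?f" by blast+
  ultimately have "0 \<in> range ?f"
    using connected_contains_Icc[of "range ?f" "?f s" "?f 0"] assms(3) \<open>\<not> ?f s > 0\<close>
    by (auto simp: flow_0[OF sq])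
  then show False using nz by auto
qed

text \<open>Carrying \<open>\<gamma> s\<close> back by the flow gives a locally constant, hence
  constant, line \<open>l\<close>. The second conclusion continues the orbit to all times, as the
  treatment of maximal geodesics requires.\<close>

lemma screw_curve_act:
  assumes "connected I" "I \<noteq> {}"
    and loc: "\<And>s. s \<in> I \<Longrightarrow> \<exists>J. open J \<and> s \<in> J \<and> connected J \<and> screw_curve \<epsilon> \<omega> v J \<gamma>"
  shows "\<exists>l. (\<forall>s\<in>I. \<gamma> s = act (flow \<epsilon> \<omega> v s) l) \<and> screw_curve \<epsilon> \<omega> v UNIV (\<lambda>s. act (flow \<epsilon> \<omega> v s) l)"
proof -
  let ?B = "\<lambda>s. act (flow \<epsilon> \<omega> v (- s)) (\<gamma> s)"
  have *: "\<exists>p e. flat \<epsilon> e e = \<epsilon> \<and> (\<epsilon> = -1 \<longrightarrow> snd e > 0) \<and> flat \<epsilon> \<omega> e = 0 \<and> flat \<epsilon> v e = flat \<epsilon> (cross \<epsilon> \<omega> e) p \<and>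
     (\<forall>s\<in>J. \<gamma> s = oriented_line (flow \<epsilon> \<omega> v s p) (flow \<epsilon> \<omega> 0 s e))"
    if J: "connected J" "a \<in> J" and sc: "screw_curve \<epsilon> \<omega> v J \<gamma>" for J a
  proof -
    obtain e p where ep: "\<And>s. s \<in> J \<Longrightarrow>
       (e has_vector_derivative cross \<epsilon> \<omega> (e s)) (at s) \<and>
       (p has_vector_derivative cross \<epsilon> \<omega> (p s) + v) (at s) \<and>
       flat \<epsilon> (e s) (e s) = \<epsilon> \<and> (\<epsilon> = -1 \<longrightarrow> snd (e s) > 0) \<and>
       flat \<epsilon> \<omega> (e s) = 0 \<and> flat \<epsilon> v (e s) = flat \<epsilon> (cross \<epsilon> \<omega> (e s)) (p s) \<and>
       \<gamma> s = oriented_line (p s) (e s)"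
      using sc unfolding screw_curve_def by blast
    \<comment> \<open>Time 0 need not lie in \<open>J\<close>. The data at \<open>a\<close> are
      carried back to 0 by the flow, which is defined for all times, so that
      \<open>screw_invariants\<close> applies on \<open>UNIV\<close>.\<close>
    define p0 e0 where "p0 = flow \<epsilon> \<omega> v (- a) (p a)" and "e0 = flow \<epsilon> \<omega> 0 (- a) (e a)"
    have p: "p s = flow \<epsilon> \<omega> v s p0" and e: "e s = flow \<epsilon> \<omega> 0 s e0" if "s \<in> J" for s
      using flow_unique[OF sq J(1) J(2) that, of p \<omega> v] flow_unique[OF sq J(1) J(2) that, of e \<omega> 0] ep
      by (simp_all add: p0_def e0_def flow_add[OF sq, symmetric])
    have ea: "e a = flow \<epsilon> \<omega> 0 a e0" "p a = flow \<epsilon> \<omega> v a p0" using p e J(2) by auto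
    note inv = screw_invariants[OF connected_UNIV, of 0 a "\<lambda>s. flow \<epsilon> \<omega> 0 s e0" \<omega>
        "\<lambda>s. flow \<epsilon> \<omega> v s p0" v, simplified flow_0[OF sq] ea[symmetric]]
    have dp: "((\<lambda>s. flow \<epsilon> \<omega> v s p0) has_vector_derivative cross \<epsilon> \<omega> (flow \<epsilon> \<omega> v s p0) + v) (at s)"
      and de: "((\<lambda>s. flow \<epsilon> \<omega> 0 s e0) has_vector_derivative cross \<epsilon> \<omega> (flow \<epsilon> \<omega> 0 s e0)) (at s)" for s
      using flow_deriv[OF sq] flow_deriv[OF sq, of \<omega> 0] by auto
    have "flat \<epsilon> e0 e0 = \<epsilon> \<and> flat \<epsilon> \<omega> e0 = 0 \<and> flat \<epsilon> v e0 = flat \<epsilon> (cross \<epsilon> \<omega> e0) p0"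
      using inv(1)[OF _ _ de dp] inv(2)[OF _ _ de dp] inv(3)[OF _ _ de dp] ep[OF J(2)] by simp
    moreover have "\<epsilon> = -1 \<longrightarrow> snd e0 > 0"
      unfolding e0_def using flow_future ep[OF J(2)] by blast
    ultimately show ?thesis
      using ep p e by (intro exI[of _ p0] exI[of _ e0]) auto
  qed
  have ev: "eventually (\<lambda>b. ?B a = ?B b) (at a within I)" if a: "a \<in> I" for a
  proof -
    obtain J where J: "open J" "a \<in> J" "connected J" "screw_curve \<epsilon> \<omega> v J \<gamma>"
      using loc[OF a] by blast
    from *[OF J(3,2,4)] obtain p e where g: "\<And>s. s \<in> J \<Longrightarrow> \<gamma> s = oriented_line (flow \<epsilon> \<omega> v s p) (flow \<epsilon> \<omega> 0 s e)"
      by blast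
    have "?B s = oriented_line p e" if "s \<in> J" for s
      by (simp add: g[OF that] act_flow_oriented_line[OF sq] flow_minus_cancel[OF sq])
    then show ?thesis
      unfolding eventually_at_topological using J(1,2) by (intro exI[of _ J]) auto
  qed
  obtain a where a: "a \<in> I" using assms(2) by blast
  obtain J where J: "a \<in> J" "connected J" "screw_curve \<epsilon> \<omega> v J \<gamma>"
    using loc[OF a] by blast
  obtain p e where pe: "flat \<epsilon> e e = \<epsilon>" "\<epsilon> = -1 \<longrightarrow> snd e > 0" "flat \<epsilon> \<omega> e = 0"
     "flat \<epsilon> v e = flat \<epsilon> (cross \<epsilon> \<omega> e) p"
     "\<And>s. s \<in> J \<Longrightarrow> \<gamma> s = oriented_line (flow \<epsilon> \<omega> v s p) (flow \<epsilon> \<omega> 0 s e)"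
    using *[OF J(2,1,3)] by blast
  define l where "l = oriented_line p e"
  have "?B a = l"
    by (simp add: pe(5)[OF J(1)] act_flow_oriented_line[OF sq] flow_minus_cancel[OF sq] l_def)
  then have B: "?B s = l" if "s \<in> I" for s
    using connected_local_const[OF assms(1) a that, of ?B] ev by auto
  have "act (flow \<epsilon> \<omega> v s) (?B s) = \<gamma> s" for s
    by (simp add: act_def image_image map_prod_def case_prod_beta flow_minus_cancel[OF sq])
  then have "\<forall>s\<in>I. \<gamma> s = act (flow \<epsilon> \<omega> v s) l" using B by metis
  moreover have "screw_curve \<epsilon> \<omega> v UNIV (\<lambda>s. act (flow \<epsilon> \<omega> v s) l)"
  proof -
    have dp: "((\<lambda>s. flow \<epsilon> \<omega> v s p) has_vector_derivative cross \<epsilon> \<omega> (flow \<epsilon> \<omega> v s p) + v) (at s)"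
      and de: "((\<lambda>s. flow \<epsilon> \<omega> 0 s e) has_vector_derivative cross \<epsilon> \<omega> (flow \<epsilon> \<omega> 0 s e)) (at s)" for s
      using flow_deriv[OF sq] flow_deriv[OF sq, of \<omega> 0] by auto
    note inv = screw_invariants[OF connected_UNIV UNIV_I UNIV_I de dp, where a = 0, simplified flow_0[OF sq]]
    show ?thesis
      unfolding screw_curve_def
      by (rule exI[of _ "\<lambda>s. flow \<epsilon> \<omega> 0 s e"], rule exI[of _ "\<lambda>s. flow \<epsilon> \<omega> v s p"], intro ballI conjI dp de)
        (use inv flow_future[of e \<omega>] pe in \<open>auto simp: l_def act_flow_oriented_line[OF sq]\<close>)
  qed
  ultimately show ?thesis by blast
qed

end

subsection \<open>Lines in holomorphic coordinates\<close>

text \<open>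
  The line with coordinates \<open>(\<xi>, \<eta>)\<close> has direction \<open>dirn \<epsilon> \<xi>\<close> and passes through \<open>foot \<epsilon> \<xi> \<eta>\<close>, which
  is the derivative of \<open>dirn \<epsilon>\<close> at \<open>\<xi>\<close> in the direction \<open>\<eta>\<close>. A point \<open>p\<close> lies on this line if and only
  if \<open>incidence \<epsilon> \<xi> p = \<eta>\<close>.
\<close>

definition dirn :: "real \<Rightarrow> complex \<Rightarrow> point" where
  "dirn \<epsilon> \<xi> = (of_real (2 / nrm \<epsilon> \<xi>) * \<xi>, 2 / nrm \<epsilon> \<xi> - 1)"

definition foot :: "real \<Rightarrow> complex \<Rightarrow> complex \<Rightarrow> point" where
  "foot \<epsilon> \<xi> \<eta> = (of_real (2 / (nrm \<epsilon> \<xi>)\<^sup>2) * (\<eta> - of_real \<epsilon> * cnj \<eta> * \<xi>\<^sup>2),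
     - 4 * \<epsilon> * Re (\<eta> * cnj \<xi>) / (nrm \<epsilon> \<xi>)\<^sup>2)"

definition incidence :: "real \<Rightarrow> complex \<Rightarrow> point \<Rightarrow> complex" where
  "incidence \<epsilon> \<xi> p = (fst p - 2 * of_real (snd p) * \<xi> - of_real \<epsilon> * cnj (fst p) * \<xi>\<^sup>2) / 2"

context
  fixes \<epsilon> :: real
  assumes sq: "\<epsilon>\<^sup>2 = 1"
begin

context
  fixes \<xi> :: complex and n :: real
  assumes nz: "nrm \<epsilon> \<xi> \<noteq> 0"
  defines "n \<equiv> inverse (nrm \<epsilon> \<xi>)"
begin

text \<open>Written in \<open>n\<close>, the algebraic identities of this context are polynomial
  consequences of these two relations.\<close>

lemma n_rel: "\<epsilon> * \<epsilon> = 1" "n * (1 + \<epsilon> * (Re \<xi> * Re \<xi> + Im \<xi> * Im \<xi>)) = 1"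
proof -
  show "\<epsilon> * \<epsilon> = 1" using sq by (simp add: power2_eq_square)
  have "n * nrm \<epsilon> \<xi> = 1" using nz by (simp add: n_def)
  then show "n * (1 + \<epsilon> * (Re \<xi> * Re \<xi> + Im \<xi> * Im \<xi>)) = 1"
    by (simp add: nrm_def cmod_def power2_eq_square)
qed

lemma dirn_n: "dirn \<epsilon> \<xi> = (of_real (2 * n) * \<xi>, 2 * n - 1)"
  by (simp add: dirn_def n_def divide_inverse)

lemma foot_n: "foot \<epsilon> \<xi> \<eta> = (of_real (2 * n * n) * (\<eta> - of_real \<epsilon> * cnj \<eta> * \<xi>\<^sup>2), - 4 * \<epsilon> * Re (\<eta> * cnj \<xi>) * n * n)"
  by (simp add: foot_def n_def divide_inverse power2_eq_square mult_ac)

lemma flat_dirn: "flat \<epsilon> (dirn \<epsilon> \<xi>) (dirn \<epsilon> \<xi>) = \<epsilon>"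
  unfolding dirn_n using n_rel by (simp add: flat_def inner_complex_def) algebra

lemma incidence_foot: "incidence \<epsilon> \<xi> (foot \<epsilon> \<xi> \<eta>) = \<eta>"
  unfolding foot_n incidence_def complex_eq_iff using n_rel
  by (simp add: power2_eq_square) algebra

lemma flat_foot_dirn: "flat \<epsilon> (foot \<epsilon> \<xi> \<eta>) (dirn \<epsilon> \<xi>) = 0"
  unfolding foot_n dirn_n using n_rel
  by (simp add: flat_def inner_complex_def power2_eq_square) algebra

text \<open>The right-hand side is the metric of \<open>N\<close>: \<open>dirn\<close> parametrises
  the unit sphere or the hyperboloid isometrically, and the tangent planes are positive definite in
  both signatures.\<close>

lemma flat_foot_foot: "flat \<epsilon> (foot \<epsilon> \<xi> \<eta>) (foot \<epsilon> \<xi> \<zeta>) = 4 * (\<eta> \<bullet> \<zeta>) * n * n"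
  unfolding foot_n using n_rel
  by (simp add: flat_def inner_complex_def power2_eq_square) algebra

text \<open>This is orthogonal projection along \<open>dirn\<close>, whose square is
  \<open>\<epsilon>\<close>: \<open>incidence\<close> forgets exactly the position of
  \<open>p\<close> along the line.\<close>

lemma foot_incidence: "foot \<epsilon> \<xi> (incidence \<epsilon> \<xi> p) = p - (\<epsilon> * flat \<epsilon> p (dirn \<epsilon> \<xi>)) *\<^sub>R dirn \<epsilon> \<xi>"
proof -
  have 1: "Re (fst (foot \<epsilon> \<xi> (incidence \<epsilon> \<xi> p))) = Re (fst (p - (\<epsilon> * flat \<epsilon> p (dirn \<epsilon> \<xi>)) *\<^sub>R dirn \<epsilon> \<xi>))"
    unfolding foot_n dirn_n incidence_def using n_rel
    by (simp add: flat_def inner_complex_def power2_eq_square) algebra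
  have 2: "Im (fst (foot \<epsilon> \<xi> (incidence \<epsilon> \<xi> p))) = Im (fst (p - (\<epsilon> * flat \<epsilon> p (dirn \<epsilon> \<xi>)) *\<^sub>R dirn \<epsilon> \<xi>))"
    unfolding foot_n dirn_n incidence_def using n_rel
    by (simp add: flat_def inner_complex_def power2_eq_square) algebra
  have 3: "snd (foot \<epsilon> \<xi> (incidence \<epsilon> \<xi> p)) = snd (p - (\<epsilon> * flat \<epsilon> p (dirn \<epsilon> \<xi>)) *\<^sub>R dirn \<epsilon> \<xi>)"
    unfolding foot_n dirn_n incidence_def using n_rel
    by (simp add: flat_def inner_complex_def power2_eq_square) algebra
  show ?thesis using 1 2 3 by (simp add: prod_eq_iff complex_eq_iff)
qed

text \<open>Only the part of \<open>\<omega>\<close> tangent to \<open>N\<close> contributes, and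
  the product with the unit direction turns it by a right angle, which is multiplication by -\<i> in
  the coordinate.\<close>

lemma cross_dirn: "cross \<epsilon> \<omega> (dirn \<epsilon> \<xi>) = foot \<epsilon> \<xi> (- \<i> * incidence \<epsilon> \<xi> \<omega>)"
proof -
  have 1: "Re (fst (cross \<epsilon> \<omega> (dirn \<epsilon> \<xi>))) = Re (fst (foot \<epsilon> \<xi> (- \<i> * incidence \<epsilon> \<xi> \<omega>)))"
    unfolding foot_n dirn_n incidence_def cross_def using n_rel
    by (simp add: power2_eq_square) algebra
  have 2: "Im (fst (cross \<epsilon> \<omega> (dirn \<epsilon> \<xi>))) = Im (fst (foot \<epsilon> \<xi> (- \<i> * incidence \<epsilon> \<xi> \<omega>)))"
    unfolding foot_n dirn_n incidence_def cross_def using n_rel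
    by (simp add: power2_eq_square) algebra
  have 3: "snd (cross \<epsilon> \<omega> (dirn \<epsilon> \<xi>)) = snd (foot \<epsilon> \<xi> (- \<i> * incidence \<epsilon> \<xi> \<omega>))"
    unfolding foot_n dirn_n incidence_def cross_def using n_rel
    by (simp add: power2_eq_square) algebra
  show ?thesis using 1 2 3 by (simp add: prod_eq_iff complex_eq_iff)
qed

text \<open>The right-hand side is the product rule applied to \<open>dirn_n\<close>, with \<xi>
  moving at velocity \<open>a\<close>.\<close>

lemma foot_eq_derivative:
  "foot \<epsilon> \<xi> a = (of_real (2 * n) * a + of_real (2 * (- 2 * \<epsilon> * (\<xi> \<bullet> a) * n\<^sup>2)) * \<xi>,
     2 * (- 2 * \<epsilon> * (\<xi> \<bullet> a) * n\<^sup>2))"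
proof -
  have "of_real (2 * n) * a + of_real (2 * (- 2 * \<epsilon> * (\<xi> \<bullet> a) * n\<^sup>2)) * \<xi> = fst (foot \<epsilon> \<xi> a)"
    unfolding foot_n complex_eq_iff using n_rel
    by (simp add: inner_complex_def power2_eq_square) algebra
  then show ?thesis
    by (simp add: foot_n inner_complex_def power2_eq_square algebra_simps)
qed

text \<open>The last component rests on 1 - |\<xi>|^4 =
  \<open>nrm \<epsilon> \<xi> * (2 - nrm \<epsilon> \<xi>)\<close>, which after division by the
  square of \<open>nrm\<close> is \<open>2 * n - 1\<close>.\<close>

lemma line_point_eq: "line_point \<epsilon> \<xi> \<eta> r = foot \<epsilon> \<xi> \<eta> + r *\<^sub>R dirn \<epsilon> \<xi>"
proof -
  have D: "1 + complex_of_real \<epsilon> * \<xi> * cnj \<xi> = of_real (nrm \<epsilon> \<xi>)"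
    using complex_norm_square[of \<xi>] by (simp add: nrm_def mult.assoc)
  have n: "complex_of_real (nrm \<epsilon> \<xi>) * of_real n = 1"
    using nz by (simp add: n_def flip: of_real_mult)
  have n': "nrm \<epsilon> \<xi> * n = 1" using nz by (simp add: n_def)
  have i: "inverse (complex_of_real (nrm \<epsilon> \<xi>)) = of_real n" by (simp add: n_def)
  have z: "(2 * (\<eta> - of_real \<epsilon> * cnj \<eta> * \<xi>\<^sup>2) + 2 * \<xi> * of_real (nrm \<epsilon> \<xi>) * of_real r) * (of_real n * of_real n)
     = 2 * of_real n * of_real n * (\<eta> - of_real \<epsilon> * cnj \<eta> * \<xi>\<^sup>2) + of_real r * (2 * of_real n * \<xi>)"
    using n by algebra
  have t: "Re ((- 2 * of_real \<epsilon> * (\<eta> * cnj \<xi> + cnj \<eta> * \<xi>) + (1 - \<xi>\<^sup>2 * (cnj \<xi>)\<^sup>2) * of_real r) * of_real (n * n))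
     = - 4 * \<epsilon> * Re (\<eta> * cnj \<xi>) * n * n + r * (2 * n - 1)"
    using n_rel by (simp add: power2_eq_square) algebra
  show ?thesis
    unfolding line_point_def Let_def D divide_inverse power2_eq_square[of "complex_of_real (nrm \<epsilon> \<xi>)"]
      inverse_mult_distrib i z
    using t by (simp add: foot_n dirn_n scaleR_conv_of_real)
qed

lemma line_of_eq: "line_of \<epsilon> (\<xi>, \<eta>) = oriented_line (foot \<epsilon> \<xi> \<eta>) (dirn \<epsilon> \<xi>)"
  by (simp add: line_of_def oriented_line_def line_point_eq)

lemma line_of_incidence: "line_of \<epsilon> (\<xi>, incidence \<epsilon> \<xi> p) = oriented_line p (dirn \<epsilon> \<xi>)"
  using oriented_line_shift[of p "- (\<epsilon> * flat \<epsilon> p (dirn \<epsilon> \<xi>))" "dirn \<epsilon> \<xi>"]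
  by (simp add: line_of_eq foot_incidence)

end

lemma inverse_nrm_deriv:
  assumes "(x has_vector_derivative a) (at s)" "nrm \<epsilon> (x s) \<noteq> 0"
  shows "((\<lambda>s. inverse (nrm \<epsilon> (x s))) has_real_derivative
    - 2 * \<epsilon> * (x s \<bullet> a) * (inverse (nrm \<epsilon> (x s)))\<^sup>2) (at s)"
proof -
  have "((\<lambda>s. nrm \<epsilon> (x s)) has_vector_derivative 2 * \<epsilon> * (x s \<bullet> a)) (at s)"
    using has_derivative_compose[OF assms(1)[unfolded has_vector_derivative_def] nrm_has_derivative, of \<epsilon>]
    by (simp add: has_vector_derivative_def mult_ac)
  then have "((\<lambda>s. nrm \<epsilon> (x s)) has_real_derivative 2 * \<epsilon> * (x s \<bullet> a)) (at s)"
    by (simp add: has_real_derivative_iff_has_vector_derivative)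
  from DERIV_inverse_fun[OF this assms(2)] show ?thesis
    by (simp add: power2_eq_square mult_ac)
qed

lemma dirn_deriv:
  assumes x: "(x has_vector_derivative a) (at s)" and nz: "nrm \<epsilon> (x s) \<noteq> 0"
  shows "((\<lambda>s. dirn \<epsilon> (x s)) has_vector_derivative foot \<epsilon> (x s) a) (at s)"
proof -
  let ?n = "inverse (nrm \<epsilon> (x s))"
  let ?d = "- 2 * \<epsilon> * (x s \<bullet> a) * ?n\<^sup>2"
  define g where "g s = inverse (nrm \<epsilon> (x s))" for s
  have g: "(g has_real_derivative ?d) (at s)"
    unfolding g_def[abs_def] by (rule inverse_nrm_deriv[OF x nz])
  have "((\<lambda>s. (of_real (2 * g s) * x s, 2 * g s - 1)) has_vector_derivative
     (of_real (2 * g s) * a + of_real (2 * ?d) * x s, 2 * ?d)) (at s)"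
    by (rule has_vector_derivative_Pair;
        rule has_vector_derivative_eq_rhs, (rule derivative_intros x g g[unfolded has_real_derivative_iff_has_vector_derivative])+, simp)
  then have "((\<lambda>s. dirn \<epsilon> (x s)) has_vector_derivative
     (of_real (2 * ?n) * a + of_real (2 * ?d) * x s, 2 * ?d)) (at s)"
    by (simp add: dirn_def divide_inverse g_def)
  then show ?thesis by (simp only: foot_eq_derivative[OF nz])
qed

end

text \<open>
  On the coordinates, the Killing field \<open>x \<mapsto> \<omega> \<times> x + v\<close> induces the holomorphic vector field
  \<open>\<xi>' = P(\<xi>)\<close>, \<open>\<eta>' = P'(\<xi>) \<eta> + incidence \<epsilon> \<xi> v\<close> with \<open>P(\<xi>) = - \<i> incidence \<epsilon> \<xi> \<omega>\<close>, and \<open>spin\<close> is \<open>P'\<close>.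
\<close>

definition spin :: "real \<Rightarrow> point \<Rightarrow> complex \<Rightarrow> complex" where
  "spin \<epsilon> \<omega> \<xi> = \<i> * (of_real (snd \<omega>) + of_real \<epsilon> * cnj (fst \<omega>) * \<xi>)"

section \<open>The infinitesimal action in coordinates\<close>

context
  fixes \<epsilon> :: real
  assumes sq: "\<epsilon>\<^sup>2 = 1"
begin

text \<open>The left-hand side is the rate of change of \<open>incidence \<epsilon> \<xi> p\<close>
  when \<open>p\<close> is rotated by \<open>\<omega>\<close> and \<xi> moves with velocity
  P(\<xi>); compare \<open>incidence_deriv\<close>. The fibre coordinate is thus transported by
  P'.\<close>

lemma incidence_cross:
  "incidence \<epsilon> \<xi> (cross \<epsilon> \<omega> p) - (of_real (snd p) + of_real \<epsilon> * cnj (fst p) * \<xi>) * (- \<i> * incidence \<epsilon> \<xi> \<omega>)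
   = spin \<epsilon> \<omega> \<xi> * incidence \<epsilon> \<xi> p"
proof -
  \<comment> \<open>Conjugates become independent variables, so that the claim is an identity of
    complex polynomials.\<close>
  define e x w t z u cw cz S where v: "e = complex_of_real \<epsilon>" "x = \<xi>" "w = fst \<omega>"
    "t = complex_of_real (snd \<omega>)" "z = fst p" "u = complex_of_real (snd p)" "cw = cnj w" "cz = cnj z"
    "S = complex_of_real (snd (cross \<epsilon> \<omega> p))"
  have 1: "e * e = 1" using sq by (simp add: v power2_eq_square flip: of_real_mult)
  have 2: "2 * S = - \<i> * e * (cw * z - w * cz)"
    by (simp add: v cross_def complex_eq_iff)
  have 3: "\<i> * \<i> = -1" by simp
  have 4: "fst (cross \<epsilon> \<omega> p) = - \<i> * (u * w - t * z)" "cnj (fst (cross \<epsilon> \<omega> p)) = \<i> * (u * cw - t * cz)"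
    by (simp_all add: v cross_def)
  have "2 * (- \<i> * (u * w - t * z) - 2 * S * x - e * (\<i> * (u * cw - t * cz)) * (x * x))
      - (u + e * cz * x) * (- \<i> * (w - 2 * t * x - e * cw * (x * x))) * 2
      = \<i> * (t + e * cw * x) * (z - 2 * u * x - e * cz * (x * x)) * 2"
    using 1 2 3 by algebra
  then show ?thesis
    unfolding incidence_def spin_def 4 v(9)[symmetric] power2_eq_square
    by (simp add: v field_simps)
qed

lemma incidence_add: "incidence \<epsilon> \<xi> (p + q) = incidence \<epsilon> \<xi> p + incidence \<epsilon> \<xi> q"
  by (simp add: incidence_def field_simps)

lemma incidence_deriv:
  assumes "(x has_vector_derivative a) (at s)" "(p has_vector_derivative p') (at s)"
  shows "((\<lambda>s. incidence \<epsilon> (x s) (p s)) has_vector_derivative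
     incidence \<epsilon> (x s) p' - (of_real (snd (p s)) + of_real \<epsilon> * cnj (fst (p s)) * x s) * a) (at s)"
proof -
  have 1: "((\<lambda>s. fst (p s)) has_vector_derivative fst p') (at s)"
    using bounded_linear.has_vector_derivative[OF bounded_linear_fst assms(2)] .
  have 2: "((\<lambda>s. complex_of_real (snd (p s))) has_vector_derivative of_real (snd p')) (at s)"
    using bounded_linear.has_vector_derivative[OF bounded_linear_compose[OF bounded_linear_of_real bounded_linear_snd] assms(2)] .
  have 3: "((\<lambda>s. cnj (fst (p s))) has_vector_derivative cnj (fst p')) (at s)"
    using bounded_linear.has_vector_derivative[OF bounded_linear_cnj 1] .
  show ?thesis
    unfolding incidence_def power2_eq_square
    by (rule has_vector_derivative_eq_rhs, (rule derivative_intros 1 2 3 assms(1))+) (simp add: field_simps)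
qed

text \<open>Orthogonality to \<open>\<omega>\<close> singles out the great circles. Multiplied by
  the velocity P(\<xi>), the formula says that the acceleration P' P is the first component of
  \<open>geodesic_acceleration\<close>.\<close>

lemma spin_eq:
  assumes nz: "nrm \<epsilon> \<xi> \<noteq> 0" and K: "flat \<epsilon> \<omega> (dirn \<epsilon> \<xi>) = 0"
  shows "spin \<epsilon> \<omega> \<xi> = 2 * of_real (\<epsilon> * inverse (nrm \<epsilon> \<xi>)) * cnj \<xi> * (- \<i> * incidence \<epsilon> \<xi> \<omega>)"
proof -
  obtain n where n: "inverse (nrm \<epsilon> \<xi>) = n" by blast
  show ?thesis
    using n_rel[OF sq nz] K unfolding dirn_n[OF sq nz] n spin_def incidence_def complex_eq_iff
    by (simp add: flat_def inner_complex_def power2_eq_square) algebra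
qed

text \<open>This is the linearisation of \<open>spin_eq\<close> in the direction \<open>- \<i> \<eta>\<close> of \<open>\<xi>\<close> and \<open>v\<close> of \<open>\<omega>\<close>.\<close>

lemma spin_variation:
  assumes nz: "nrm \<epsilon> \<xi> \<noteq> 0" and K: "flat \<epsilon> \<omega> (dirn \<epsilon> \<xi>) = 0"
    and K2: "flat \<epsilon> v (dirn \<epsilon> \<xi>) = flat \<epsilon> (cross \<epsilon> \<omega> (dirn \<epsilon> \<xi>)) (foot \<epsilon> \<xi> \<eta>)"
    and a: "a = - \<i> * incidence \<epsilon> \<xi> \<omega>" and b: "b = spin \<epsilon> \<omega> \<xi> * \<eta> + incidence \<epsilon> \<xi> v"
    and E: "E = complex_of_real (\<epsilon> * inverse (nrm \<epsilon> \<xi>))"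
  shows "\<i> * of_real \<epsilon> * cnj (fst \<omega>) * \<eta> - (of_real (snd v) + of_real \<epsilon> * cnj (fst v) * \<xi>)
     = 2 * E * cnj \<xi> * b - 2 * E * cnj \<eta> * a - 2 * E\<^sup>2 * cnj \<xi> * (\<eta> * cnj \<xi> - \<xi> * cnj \<eta>) * a"
proof -
  define n where "n = inverse (nrm \<epsilon> \<xi>)"
  define e m x y w t w2 t2 cx cy cw cw2 ca where v: "e = complex_of_real \<epsilon>" "m = complex_of_real n" "x = \<xi>" "y = \<eta>" "w = fst \<omega>"
    "t = complex_of_real (snd \<omega>)" "w2 = fst v" "t2 = complex_of_real (snd v)"
    "cx = cnj x" "cy = cnj y" "cw = cnj w" "cw2 = cnj w2" "ca = cnj a"
  note rel = n_rel[OF sq nz, folded n_def]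
  have 1: "e * e = 1" using rel(1) by (simp add: v flip: of_real_mult)
  have 2: "m * (1 + e * (x * cx)) = 1"
    using rel(2) by (simp add: v complex_eq_iff algebra_simps)
  have 3: "m * (w * cx + cw * x) + e * (2 * m - 1) * t = 0"
    using K unfolding dirn_n[OF sq nz, folded n_def]
    by (simp add: v complex_eq_iff flat_def inner_complex_def algebra_simps)
  have "flat \<epsilon> v (dirn \<epsilon> \<xi>) = 4 * (a \<bullet> \<eta>) * n * n"
    unfolding K2 cross_dirn[OF sq nz] flat_foot_foot[OF sq nz] a n_def by simp
  then have 4: "m * (w2 * cx + cw2 * x) + e * (2 * m - 1) * t2 = 2 * m * m * (ca * y + a * cy)"
    unfolding dirn_n[OF sq nz, folded n_def]
    by (simp add: v complex_eq_iff flat_def inner_complex_def algebra_simps)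
  have 5: "2 * a = - \<i> * (w - 2 * t * x - e * cw * x * x)" "2 * ca = \<i> * (cw - 2 * t * cx - e * w * cx * cx)"
    by (simp_all add: a incidence_def v power2_eq_square)
  have 6: "2 * b = 2 * \<i> * (t + e * cw * x) * y + w2 - 2 * t2 * x - e * cw2 * x * x"
    by (simp add: b spin_def incidence_def v power2_eq_square field_simps)
  have 7: "\<i> * \<i> = -1" by simp
  have 8: "w = 2 * \<i> * m * m * (a + e * x * x * ca)" "cw = - 2 * \<i> * m * m * (ca + e * cx * cx * a)"
    using 1 2 3 5 7 by algebra+
  have "\<i> * e * cw * y - (t2 + e * cw2 * x)
     = 2 * (e * m) * cx * b - 2 * (e * m) * cy * a - 2 * ((e * m) * (e * m)) * cx * (y * cx - x * cy) * a"
    using 1 2 3 4 5 6 7 8 by algebra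
  then show ?thesis by (simp add: E v power2_eq_square flip: n_def)
qed

end

subsection \<open>Orbits are geodesics\<close>

context
  fixes \<epsilon> :: real
  assumes sq: "\<epsilon>\<^sup>2 = 1"
begin

text \<open>Projection from the pole \<open>(0, -1)\<close>, which inverts \<open>dirn\<close>.
  Normalisation of \<open>e\<close> means \<open>\<epsilon> * (cmod (fst e))\<^sup>2 = (1 - snd e) *
  (1 + snd e)\<close>.\<close>

lemma stereographic:
  assumes e: "flat \<epsilon> e e = \<epsilon>" and t: "1 + snd e \<noteq> 0"
  defines "\<xi> \<equiv> fst e / of_real (1 + snd e)"
  shows "nrm \<epsilon> \<xi> = 2 / (1 + snd e)" "dirn \<epsilon> \<xi> = e"
proof -
  have c: "(cmod (fst e))\<^sup>2 = \<epsilon> - \<epsilon> * (snd e)\<^sup>2"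
    using e by (simp add: flat_def dot_square_norm power2_eq_square[of "snd e"])
  have 1: "\<epsilon> * (cmod (fst e))\<^sup>2 = 1 - (snd e)\<^sup>2"
    unfolding c using sq by (simp add: right_diff_distrib power2_eq_square[of \<epsilon>] flip: mult.assoc)
  obtain u where u: "1 + snd e = u" by blast
  have \<xi>: "\<xi> = fst e / of_real u" by (simp only: \<xi>_def u)
  have s: "snd e = u - 1" and u0: "u \<noteq> 0" using u t by auto
  have "nrm \<epsilon> \<xi> = 1 + \<epsilon> * (cmod (fst e))\<^sup>2 / u\<^sup>2"
    by (simp add: nrm_def \<xi> norm_divide power_divide)
  also have "\<dots> = 2 / u"
    unfolding 1 s using u0 by (simp add: field_simps power2_eq_square)
  finally have n: "nrm \<epsilon> \<xi> = 2 / u" .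
  then show "nrm \<epsilon> \<xi> = 2 / (1 + snd e)" by (simp only: u)
  show "dirn \<epsilon> \<xi> = e"
    unfolding dirn_def n using u0 by (simp add: \<xi> s prod_eq_iff)
qed

lemma screw_coordinates_geodesic:
  assumes eps: "\<epsilon> = 1 \<or> \<epsilon> = -1"
    and e': "\<And>s. s \<in> J \<Longrightarrow> (e has_vector_derivative cross \<epsilon> \<omega> (e s)) (at s)"
    and p': "\<And>s. s \<in> J \<Longrightarrow> (p has_vector_derivative cross \<epsilon> \<omega> (p s) + v) (at s)"
    and unit: "\<And>s. s \<in> J \<Longrightarrow> flat \<epsilon> (e s) (e s) = \<epsilon>"
    and fut: "\<And>s. s \<in> J \<Longrightarrow> \<epsilon> = -1 \<Longrightarrow> snd (e s) > 0"
    and chart: "\<And>s. s \<in> J \<Longrightarrow> 1 + snd (e s) \<noteq> 0"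
    and K: "\<And>s. s \<in> J \<Longrightarrow> flat \<epsilon> \<omega> (e s) = 0"
    and K2: "\<And>s. s \<in> J \<Longrightarrow> flat \<epsilon> v (e s) = flat \<epsilon> (cross \<epsilon> \<omega> (e s)) (p s)"
  shows "\<exists>c. (\<forall>s\<in>J. c s \<in> coord_dom \<epsilon> \<and> line_of \<epsilon> (c s) = oriented_line (p s) (e s)) \<and>
    coord_geodesic (neutral_metric (conf \<epsilon>)) J c"
proof -
  define x where "x s = fst (e s) / of_real (1 + snd (e s))" for s
  define y where "y s = incidence \<epsilon> (x s) (p s)" for s
  \<comment> \<open>\<open>a\<close> and \<open>b\<close> are the values of the induced vector
    field; that they are the velocities of \<open>x\<close> and \<open>y\<close> is shown
    below.\<close>
  define a where "a s = - \<i> * incidence \<epsilon> (x s) \<omega>" for s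
  define b where "b s = spin \<epsilon> \<omega> (x s) * y s + incidence \<epsilon> (x s) v" for s
  have nx: "nrm \<epsilon> (x s) = 2 / (1 + snd (e s))" and dx: "dirn \<epsilon> (x s) = e s" if "s \<in> J" for s
    using stereographic[OF unit[OF that] chart[OF that]] by (simp_all add: x_def)
  have nz: "nrm \<epsilon> (x s) \<noteq> 0" if "s \<in> J" for s
    using nx[OF that] chart[OF that] by simp
  have x': "(x has_vector_derivative a s) (at s)" if s: "s \<in> J" for s
  proof -
    define n where "n = inverse (nrm \<epsilon> (x s))"
    have n: "1 + snd (e s) = 2 * n" "n \<noteq> 0" using nx[OF s] nz[OF s] by (auto simp: n_def)
    \<comment> \<open>\<open>foot_eq_derivative\<close> is read backwards here, from the velocity of
      \<open>e\<close> to that of \<open>x\<close>; \<open>d\<close> is the velocity of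
      \<open>snd (e s)\<close>.\<close>
    define d where "d = 2 * (- 2 * \<epsilon> * (x s \<bullet> a s) * n\<^sup>2)"
    have c: "cross \<epsilon> \<omega> (e s) = (of_real (2 * n) * a s + of_real d * x s, d)"
      using cross_dirn[OF sq nz[OF s], of \<omega>] foot_eq_derivative[OF sq nz[OF s], of "a s"]
      by (simp add: dx[OF s] a_def[of s] n_def d_def)
    have 1: "((\<lambda>s. fst (e s)) has_vector_derivative of_real (2 * n) * a s + of_real d * x s) (at s)"
      using bounded_linear.has_vector_derivative[OF bounded_linear_fst e'[OF s]] c by simp
    have "((\<lambda>s. snd (e s)) has_vector_derivative d) (at s)"
      using bounded_linear.has_vector_derivative[OF bounded_linear_snd e'[OF s]] c by simp
    then have "((\<lambda>s. 1 + snd (e s)) has_real_derivative d) (at s)"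
      by (auto simp: has_real_derivative_iff_has_vector_derivative intro!: derivative_eq_intros)
    from DERIV_inverse_fun[OF this chart[OF s]]
    have 2: "((\<lambda>s. inverse (1 + snd (e s))) has_real_derivative - d * (inverse (2 * n))\<^sup>2) (at s)"
      unfolding n by (simp add: power2_eq_square)
    have fx: "fst (e s) = of_real (2 * n) * x s"
      using dx[OF s] unfolding dirn_n[OF sq nz[OF s]] n_def by (metis fst_conv)
    have "((\<lambda>s. inverse (1 + snd (e s)) *\<^sub>R fst (e s)) has_vector_derivative
       inverse (1 + snd (e s)) *\<^sub>R (of_real (2 * n) * a s + of_real d * x s)
       + (- d * (inverse (2 * n))\<^sup>2) *\<^sub>R fst (e s)) (at s)"
      by (rule has_vector_derivative_scaleR[OF 2 1])
    moreover have "inverse (1 + snd (e s)) *\<^sub>R (of_real (2 * n) * a s + of_real d * x s)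
       + (- d * (inverse (2 * n))\<^sup>2) *\<^sub>R fst (e s) = a s"
      unfolding n fx using n(2) by (simp add: scaleR_conv_of_real field_simps power2_eq_square)
    moreover have "(\<lambda>s. inverse (1 + snd (e s)) *\<^sub>R fst (e s)) = x"
      by (simp add: x_def fun_eq_iff scaleR_conv_of_real divide_inverse mult.commute)
    ultimately show ?thesis by simp
  qed
  have y': "(y has_vector_derivative b s) (at s)" if s: "s \<in> J" for s
  proof -
    have "incidence \<epsilon> (x s) (cross \<epsilon> \<omega> (p s) + v)
        - (of_real (snd (p s)) + of_real \<epsilon> * cnj (fst (p s)) * x s) * a s = b s"
      using incidence_cross[OF sq, of "x s" \<omega> "p s"]
      unfolding incidence_add[OF sq] b_def y_def a_def by algebra
    then show ?thesis
      using incidence_deriv[OF sq x'[OF s] p'[OF s]] by (simp only: y_def[abs_def])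
  qed
  have a': "(a has_vector_derivative spin \<epsilon> \<omega> (x s) * a s) (at s)" if s: "s \<in> J" for s
  proof -
    have "((\<lambda>s. incidence \<epsilon> (x s) \<omega>) has_vector_derivative
      incidence \<epsilon> (x s) 0 - (of_real (snd \<omega>) + of_real \<epsilon> * cnj (fst \<omega>) * x s) * a s) (at s)"
      by (rule incidence_deriv[OF sq x'[OF s] has_vector_derivative_const])
    from has_vector_derivative_mult_right[OF this, of "- \<i>"]
    have "(a has_vector_derivative - \<i> * (incidence \<epsilon> (x s) 0
        - (of_real (snd \<omega>) + of_real \<epsilon> * cnj (fst \<omega>) * x s) * a s)) (at s)"
      by (simp only: a_def[abs_def])
    then show ?thesis
      by (simp add: spin_def incidence_def[of _ _ 0] algebra_simps)
  qed
  \<comment> \<open>The factor of \<open>y s\<close> is P'', and the subtracted bracket is minus the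
    \<xi>-derivative of \<open>incidence \<epsilon> \<xi> v\<close>.\<close>
  have b': "(b has_vector_derivative spin \<epsilon> \<omega> (x s) * b s + (\<i> * of_real \<epsilon> * cnj (fst \<omega>) * y s
      - (of_real (snd v) + of_real \<epsilon> * cnj (fst v) * x s)) * a s) (at s)" if s: "s \<in> J" for s
  proof -
    have 1: "((\<lambda>s. incidence \<epsilon> (x s) v) has_vector_derivative
      incidence \<epsilon> (x s) 0 - (of_real (snd v) + of_real \<epsilon> * cnj (fst v) * x s) * a s) (at s)"
      by (rule incidence_deriv[OF sq x'[OF s] has_vector_derivative_const])
    have 2: "((\<lambda>s. spin \<epsilon> \<omega> (x s)) has_vector_derivative \<i> * of_real \<epsilon> * cnj (fst \<omega>) * a s) (at s)"
      unfolding spin_def by (rule has_vector_derivative_eq_rhs, (rule derivative_intros x'[OF s])+) simp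
    show ?thesis
      unfolding b_def[abs_def]
      by (rule has_vector_derivative_eq_rhs, (rule has_vector_derivative_add has_vector_derivative_mult 1 2 y'[OF s])+)
        (simp add: incidence_def[of _ _ 0] b_def[of s] algebra_simps)
  qed
  have dom: "(x s, y s) \<in> coord_dom \<epsilon>" if s: "s \<in> J" for s
  proof (cases "\<epsilon> = 1")
    case False
    then have "\<epsilon> = -1" using eps by simp
    moreover from this have "nrm \<epsilon> (x s) > 0" using nx[OF s] fut[OF s] by simp
    ultimately have "(cmod (x s))\<^sup>2 < 1" by (simp add: nrm_def)
    then show ?thesis by (simp add: coord_dom_def abs_square_less_1)
  qed (simp add: coord_dom_def)
  have geo: "geodesic_acceleration \<epsilon> (x s, y s) (a s, b s) = (spin \<epsilon> \<omega> (x s) * a s, spin \<epsilon> \<omega> (x s) * b s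
      + (\<i> * of_real \<epsilon> * cnj (fst \<omega>) * y s - (of_real (snd v) + of_real \<epsilon> * cnj (fst v) * x s)) * a s)"
    if s: "s \<in> J" for s
  proof -
    define E where "E = complex_of_real (\<epsilon> * inverse (nrm \<epsilon> (x s)))"
    have K1: "flat \<epsilon> \<omega> (dirn \<epsilon> (x s)) = 0" using K[OF s] by (simp add: dx[OF s])
    \<comment> \<open>The foot and \<open>p s\<close> differ by a multiple of \<open>e s\<close>,
      which is orthogonal to \<open>cross \<epsilon> \<omega> (e s)\<close>; the second condition
      may be moved to the foot.\<close>
    have "flat \<epsilon> (cross \<epsilon> \<omega> (e s)) (foot \<epsilon> (x s) (y s)) = flat \<epsilon> (cross \<epsilon> \<omega> (e s)) (p s)"
      unfolding y_def foot_incidence[OF sq nz[OF s]] dx[OF s]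
      by (simp add: flat_diff_right flat_scaleR_right flat_cross_self[OF sq])
    then have "flat \<epsilon> v (dirn \<epsilon> (x s)) = flat \<epsilon> (cross \<epsilon> \<omega> (dirn \<epsilon> (x s))) (foot \<epsilon> (x s) (y s))"
      using K2[OF s] by (simp add: dx[OF s])
    from spin_variation[OF sq nz[OF s] K1 this a_def b_def E_def]
    have 1: "\<i> * of_real \<epsilon> * cnj (fst \<omega>) * y s - (of_real (snd v) + of_real \<epsilon> * cnj (fst v) * x s)
     = 2 * E * cnj (x s) * b s - 2 * E * cnj (y s) * a s
       - 2 * E\<^sup>2 * cnj (x s) * (y s * cnj (x s) - x s * cnj (y s)) * a s" .
    have 2: "spin \<epsilon> \<omega> (x s) = 2 * E * cnj (x s) * a s"
      using spin_eq[OF sq nz[OF s] K1] by (simp add: E_def a_def)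
    show ?thesis
      unfolding geodesic_acceleration_def prod.case Let_def divide_inverse E_def[symmetric] 1
      by (simp add: 2 power2_eq_square algebra_simps)
  qed
  show ?thesis
  proof (intro exI[of _ "\<lambda>s. (x s, y s)"] conjI ballI)
    fix s assume s: "s \<in> J"
    show "(x s, y s) \<in> coord_dom \<epsilon>" by (rule dom[OF s])
    show "line_of \<epsilon> (x s, y s) = oriented_line (p s) (e s)"
      unfolding y_def line_of_incidence[OF sq nz[OF s]] dx[OF s] ..
  next
    have "((\<lambda>s. (x s, y s)) has_vector_derivative (a s, b s)) (at s) \<and>
        ((\<lambda>s. (a s, b s)) has_vector_derivative geodesic_acceleration \<epsilon> (x s, y s) (a s, b s)) (at s)" if s: "s \<in> J" for s
      unfolding geo[OF s] by (intro conjI has_vector_derivative_Pair x'[OF s] y'[OF s] a'[OF s] b'[OF s])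
    then show "coord_geodesic (neutral_metric (conf \<epsilon>)) J (\<lambda>s. (x s, y s))"
      by (subst coord_geodesic_iff[OF eps]) (auto simp: dom intro!: exI[of _ "\<lambda>s. (a s, b s)"])
  qed
qed

end

section \<open>The half-turn and the chart around the south pole\<close>

lemma bounded_linear_half_turn: "bounded_linear half_turn"
  unfolding linear_conv_bounded_linear[symmetric] half_turn_def
  by (rule linearI) auto

lemma half_turn_half_turn [simp]: "half_turn (half_turn x) = x"
  by (cases x) (simp add: half_turn_def)

text \<open>The half-turn is a rotation; a reflection would introduce a sign.\<close>

lemma half_turn_cross: "half_turn (cross 1 \<omega> x) = cross 1 (half_turn \<omega>) (half_turn x)"
  by (cases \<omega>; cases x) (simp add: half_turn_def cross_def algebra_simps)

lemma flat_half_turn: "flat \<epsilon> (half_turn x) (half_turn y) = flat \<epsilon> x y"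
  by (cases x; cases y) (simp add: half_turn_def flat_def inner_complex_def)

lemma act_half_turn_oriented_line:
  "act half_turn (oriented_line p e) = oriented_line (half_turn p) (half_turn e)"
proof -
  have "half_turn (q + r *\<^sub>R w) = half_turn q + r *\<^sub>R half_turn w" for q w r
    by (simp add: linear_add linear_scale bounded_linear.linear[OF bounded_linear_half_turn])
  then show ?thesis
    by (simp add: oriented_line_image act_def image_image map_prod_def case_prod_beta)
qed

lemma act_half_turn_twice [simp]: "act half_turn (act half_turn l) = l"
  by (simp add: act_def image_image map_prod_def case_prod_beta)

lemma screw_curve_half_turn:
  assumes "screw_curve 1 \<omega> v J \<gamma>"
  shows "screw_curve 1 (half_turn \<omega>) (half_turn v) J (\<lambda>s. act half_turn (\<gamma> s))"
proof -
  obtain e p where ep: "\<forall>s\<in>J.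
     (e has_vector_derivative cross 1 \<omega> (e s)) (at s) \<and>
     (p has_vector_derivative cross 1 \<omega> (p s) + v) (at s) \<and>
     flat 1 (e s) (e s) = 1 \<and> 
     flat 1 \<omega> (e s) = 0 \<and> flat 1 v (e s) = flat 1 (cross 1 \<omega> (e s)) (p s) \<and>
     \<gamma> s = oriented_line (p s) (e s)"
    using assms unfolding screw_curve_def by blast
  have add: "half_turn (x + y) = half_turn x + half_turn y" for x y
    by (rule linear_add[OF bounded_linear.linear[OF bounded_linear_half_turn]])
  have D: "((\<lambda>s. half_turn (e s)) has_vector_derivative cross 1 (half_turn \<omega>) (half_turn (e s))) (at s)"
    "((\<lambda>s. half_turn (p s)) has_vector_derivative cross 1 (half_turn \<omega>) (half_turn (p s)) + half_turn v) (at s)"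
    if "s \<in> J" for s
    using bounded_linear.has_vector_derivative[OF bounded_linear_half_turn, of e _ "at s"]
      bounded_linear.has_vector_derivative[OF bounded_linear_half_turn, of p _ "at s"] ep that
    by (metis half_turn_cross, metis half_turn_cross add)
  show ?thesis
    unfolding screw_curve_def
    by (rule exI[of _ "\<lambda>s. half_turn (e s)"], rule exI[of _ "\<lambda>s. half_turn (p s)"])
      (use ep D in \<open>auto simp: flat_half_turn act_half_turn_oriented_line simp flip: half_turn_cross\<close>)
qed

text \<open>The first chart misses only the direction \<open>(0, -1)\<close>, and the half-turn
  sends this to \<open>(0, 1)\<close>, so near such a time the rotated curve is treated instead. The
  set \<open>J\<close> of times away from the missing direction is open, possibly
  disconnected.\<close>

lemma geodesic_screw_curve:
  assumes eps: "\<epsilon> = 1 \<or> \<epsilon> = -1" and sc: "screw_curve \<epsilon> \<omega> v UNIV \<gamma>"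
  shows "geodesic \<epsilon> UNIV \<gamma>"
proof -
  have sq: "\<epsilon>\<^sup>2 = 1" using eps by auto
  have north: "\<exists>J c. open J \<and> s \<in> J \<and> J \<subseteq> UNIV \<and> (\<forall>r\<in>J. c r \<in> coord_dom \<epsilon> \<and> \<gamma> r = line_of \<epsilon> (c r)) \<and>
      coord_geodesic (neutral_metric (conf \<epsilon>)) J c"
    if sc: "screw_curve \<epsilon> \<omega> v UNIV \<gamma>" and not: "\<And>q. \<gamma> s \<noteq> oriented_line q (0, -1)" for \<omega> v \<gamma> s
  proof -
    obtain e p where ep: "\<And>s.
       (e has_vector_derivative cross \<epsilon> \<omega> (e s)) (at s) \<and>
       (p has_vector_derivative cross \<epsilon> \<omega> (p s) + v) (at s) \<and>
       flat \<epsilon> (e s) (e s) = \<epsilon> \<and> (\<epsilon> = -1 \<longrightarrow> snd (e s) > 0) \<and>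
       flat \<epsilon> \<omega> (e s) = 0 \<and> flat \<epsilon> v (e s) = flat \<epsilon> (cross \<epsilon> \<omega> (e s)) (p s) \<and>
       \<gamma> s = oriented_line (p s) (e s)"
      using sc unfolding screw_curve_def by blast
    define J where "J = {s. 1 + snd (e s) \<noteq> 0}"
    have "continuous_on UNIV e"
      by (rule continuous_on_vector_derivative, rule has_vector_derivative_at_within) (use ep in blast)
    then have "continuous_on UNIV (\<lambda>s. 1 + snd (e s))" by (intro continuous_intros)
    then have "open ((\<lambda>s. 1 + snd (e s)) -` (- {0}))" by (rule open_vimage[rotated]) auto
    then have oJ: "open J" by (simp add: J_def vimage_def)
    have sJ: "s \<in> J"
    proof (rule ccontr)
      assume "s \<notin> J"
      then have t: "snd (e s) = -1" by (simp add: J_def)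
      have "flat \<epsilon> (e s) (e s) = \<epsilon>" using ep by blast
      then have "fst (e s) = 0" by (simp add: flat_def t)
      then have "e s = (0, -1)" using t by (simp add: prod_eq_iff)
      then show False using not[of "p s"] ep[of s] by simp
    qed
    obtain c where "\<forall>s\<in>J. c s \<in> coord_dom \<epsilon> \<and> line_of \<epsilon> (c s) = oriented_line (p s) (e s)"
      "coord_geodesic (neutral_metric (conf \<epsilon>)) J c"
      using screw_coordinates_geodesic[OF sq eps, of J e \<omega> p v] ep unfolding J_def by blast
    then show ?thesis using oJ sJ ep by (intro exI[of _ J] exI[of _ c]) auto
  qed
  have "\<exists>\<kappa>\<in>charts \<epsilon>. \<exists>J c. open J \<and> s \<in> J \<and> J \<subseteq> UNIV \<and> (\<forall>r\<in>J. c r \<in> coord_dom \<epsilon> \<and> \<gamma> r = \<kappa> (c r)) \<and>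
      coord_geodesic (neutral_metric (conf \<epsilon>)) J c" for s
  proof (cases "\<exists>q. \<gamma> s = oriented_line q (0, -1)")
    case False
    have "line_of \<epsilon> \<in> charts \<epsilon>" by (simp add: charts_def)
    with north[OF sc, of s] False show ?thesis by blast
  next
    case True
    then obtain q where q: "\<gamma> s = oriented_line q (0, -1)" ..
    \<comment> \<open>Future directions have positive last coordinate, so only the Euclidean case
      meets the missing fibre.\<close>
    have "\<epsilon> \<noteq> -1"
    proof
      assume e1: "\<epsilon> = -1"
      obtain q' f where "flat \<epsilon> f f = \<epsilon>" "snd f > 0" "\<gamma> s = oriented_line q' f"
        using sc e1 unfolding screw_curve_def by blast
      then show False
        using oriented_line_eq_imp(1)[of q "(0, -1)" q' f \<epsilon>] q e1 by (auto simp: flat_def)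
    qed
    then have e1: "\<epsilon> = 1" using eps by simp
    have "act half_turn (\<gamma> s) = oriented_line (half_turn q) (0, 1)"
      by (simp add: q act_half_turn_oriented_line) (simp add: half_turn_def)
    then have "act half_turn (\<gamma> s) \<noteq> oriented_line q' (0, -1)" for q'
      using oriented_line_eq_imp(1)[of "half_turn q" "(0, 1)" q' "(0, -1)" 1] by (auto simp: flat_def)
    from north[OF screw_curve_half_turn[OF sc[unfolded e1], folded e1] this]
    obtain J c where J: "open J" "s \<in> J" "\<forall>r\<in>J. c r \<in> coord_dom \<epsilon> \<and> act half_turn (\<gamma> r) = line_of \<epsilon> (c r)"
      "coord_geodesic (neutral_metric (conf \<epsilon>)) J c" by blast
    have "\<forall>r\<in>J. \<gamma> r = (act half_turn \<circ> line_of \<epsilon>) (c r)"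
      using J(3) by (metis act_half_turn_twice comp_apply)
    moreover have "act half_turn \<circ> line_of \<epsilon> \<in> charts \<epsilon>" by (simp add: charts_def e1)
    ultimately show ?thesis using J by blast
  qed
  then show ?thesis unfolding geodesic_def by auto
qed

subsection \<open>Geodesics are orbits\<close>

text \<open>
  Along a geodesic \<open>\<omega> = foot \<epsilon> \<xi> (\<i> \<xi>')\<close> is constant, and \<open>momentum\<close> is the linearisation of this
  expression in the direction \<open>- \<i> (\<eta>, \<eta>')\<close> of \<open>(\<xi>, \<xi>')\<close>.
\<close>

definition momentum :: "real \<Rightarrow> complex \<times> complex \<Rightarrow> complex \<times> complex \<Rightarrow> point" where
  "momentum \<epsilon> = (\<lambda>(\<xi>, \<eta>) (a, b). let n = inverse (nrm \<epsilon> \<xi>); k = \<eta> * cnj \<xi> - \<xi> * cnj \<eta> in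
     (2 * of_real (n * n) * (b + 2 * of_real \<epsilon> * \<xi> * \<eta> * cnj a - of_real \<epsilon> * \<xi> * \<xi> * cnj b)
        - 4 * of_real (\<epsilon> * n * n * n) * (a + of_real \<epsilon> * \<xi> * \<xi> * cnj a) * k,
      - 4 * \<epsilon> * n * n * Re (cnj \<xi> * b - cnj \<eta> * a) + 4 * n * n * n * Re ((cnj \<xi> * a - \<xi> * cnj a) * k)))"

context
  fixes \<epsilon> :: real
  assumes sq: "\<epsilon>\<^sup>2 = 1"
begin

text \<open>With \<open>\<omega>\<close> for \<open>foot \<epsilon> \<xi> (\<i> * a)\<close>, these
  are the linearisations of \<open>incidence \<epsilon> \<xi> \<omega> = \<i> * a\<close> and
  \<open>flat \<epsilon> \<omega> (dirn \<epsilon> \<xi>) = 0\<close> along -\<i> (\<eta>, b). They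
  supply the velocity of the fibre coordinate and the second condition of
  \<open>screw_curve\<close>.\<close>

lemma incidence_momentum:
  assumes nz: "nrm \<epsilon> \<xi> \<noteq> 0"
  shows "incidence \<epsilon> \<xi> (momentum \<epsilon> (\<xi>, \<eta>) (a, b)) = b - spin \<epsilon> (foot \<epsilon> \<xi> (\<i> * a)) \<xi> * \<eta>" (is ?inc)
    and "flat \<epsilon> (momentum \<epsilon> (\<xi>, \<eta>) (a, b)) (dirn \<epsilon> \<xi>) = flat \<epsilon> (foot \<epsilon> \<xi> a) (foot \<epsilon> \<xi> \<eta>)" (is ?flat)
proof -
  define n where "n = inverse (nrm \<epsilon> \<xi>)"
  define v where "v = momentum \<epsilon> (\<xi>, \<eta>) (a, b)"
  define \<omega> where "\<omega> = foot \<epsilon> \<xi> (\<i> * a)"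
  define e m x y cx cy ca cb w2 cw2 t2 t cw where d: "e = complex_of_real \<epsilon>" "m = complex_of_real n" "x = \<xi>" "y = \<eta>"
    "cx = cnj x" "cy = cnj y" "ca = cnj a" "cb = cnj b" "w2 = fst v" "cw2 = cnj (fst v)" "t2 = complex_of_real (snd v)"
    "t = complex_of_real (snd \<omega>)" "cw = cnj (fst \<omega>)"
  note rel = n_rel[OF sq nz, folded n_def]
  note v' = v_def[unfolded momentum_def prod.case Let_def, folded n_def]
  have 1: "e * e = 1" using rel(1) by (simp add: d flip: of_real_mult)
  have 2: "m * (1 + e * (x * cx)) = 1"
    using rel(2) by (simp add: d complex_eq_iff algebra_simps)
  have 3: "w2 = 2 * m * m * (b + 2 * e * x * y * ca - e * x * x * cb)
      - 4 * e * m * m * m * (a + e * x * x * ca) * (y * cx - x * cy)"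
    "cw2 = 2 * m * m * (cb + 2 * e * cx * cy * a - e * cx * cx * b)
      + 4 * e * m * m * m * (ca + e * cx * cx * a) * (y * cx - x * cy)"
    by (simp_all add: d v' algebra_simps)
  have 4: "t2 = - 2 * e * m * m * (cx * b + x * cb - cy * a - y * ca)
      + 4 * m * m * m * (cx * a - x * ca) * (y * cx - x * cy)"
    by (simp add: d v' complex_eq_iff algebra_simps)
  have 5: "t = - 2 * \<i> * e * m * m * (cx * a - x * ca)" "cw = - 2 * \<i> * m * m * (ca + e * cx * cx * a)"
    by (simp_all add: d \<omega>_def foot_n[OF sq nz, folded n_def] complex_eq_iff power2_eq_square algebra_simps)
  \<comment> \<open>\<open>D\<close> is \<open>nrm\<close>. With the products \<open>m * D\<close>
    kept visible, the identities hold modulo \<open>e * e = 1\<close> alone, and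
    \<open>m * D = 1\<close> is substituted last.\<close>
  define D where "D = 1 + e * (x * cx)"
  have mD: "m * D = 1" using 2 by (simp add: D_def)
  have s1: "w2 - 2 * t2 * x - e * cw2 * (x * x)
      = 2 * (m * m * D * D) * b - 4 * e * m * (m * D) * x * cy * a - 4 * e * m * (m * m * D * D) * a * (y * cx - x * cy)"
    unfolding 3 4 D_def using 1 by algebra
  have s2: "\<i> * (t + e * cw * x) = 2 * e * m * a * cx * (m * D)"
  proof -
    have "\<i> * \<i> = -1" by simp
    then show ?thesis unfolding 5 D_def using 1 by algebra
  qed
  have s3: "m * m * D * D = 1" using mD by algebra
  have "w2 - 2 * t2 * x - e * cw2 * (x * x) = 2 * (b - \<i> * (t + e * cw * x) * y)"
    unfolding s1 s2 s3 mD by (simp add: algebra_simps)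
  then show ?inc
    by (simp add: incidence_def spin_def d power2_eq_square field_simps flip: v_def \<omega>_def)
  have "m * (w2 * cx + cw2 * x) + e * (m * (1 - e * (x * cx))) * t2 = 2 * m * m * (m * D) * (ca * y + a * cy)"
    unfolding 3 4 D_def using 1 by algebra
  moreover have "2 * m - 1 = m * (1 - e * (x * cx))" using 2 by algebra
  ultimately have "m * (w2 * cx + cw2 * x) + e * (2 * m - 1) * t2 = 2 * m * m * (ca * y + a * cy)"
    by (simp add: mD)
  then show ?flat
    unfolding flat_foot_foot[OF sq nz] dirn_n[OF sq nz] n_def[symmetric] v_def[symmetric]
    by (simp add: d complex_eq_iff flat_def inner_complex_def algebra_simps)
qed

text \<open>The first quantity is the vector product of the direction with its velocity, which is
  constant on a great circle. The second is its first variation through geodesics, since the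
  acceleration of the fibre coordinate is the linearised one.\<close>

lemma momenta_constant:
  assumes J: "connected J" "s \<in> J" "r \<in> J"
    and nz: "\<And>s. s \<in> J \<Longrightarrow> nrm \<epsilon> (x s) \<noteq> 0"
    and x': "\<And>s. s \<in> J \<Longrightarrow> (x has_vector_derivative a s) (at s)"
    and y': "\<And>s. s \<in> J \<Longrightarrow> (y has_vector_derivative b s) (at s)"
    and a': "\<And>s. s \<in> J \<Longrightarrow> (a has_vector_derivative fst (geodesic_acceleration \<epsilon> (x s, y s) (a s, b s))) (at s)"
    and b': "\<And>s. s \<in> J \<Longrightarrow> (b has_vector_derivative snd (geodesic_acceleration \<epsilon> (x s, y s) (a s, b s))) (at s)"
  shows "foot \<epsilon> (x s) (\<i> * a s) = foot \<epsilon> (x r) (\<i> * a r)"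
    and "momentum \<epsilon> (x s, y s) (a s, b s) = momentum \<epsilon> (x r, y r) (a r, b r)"
proof -
  define n where "n s = inverse (nrm \<epsilon> (x s))" for s
  define m where "m s = complex_of_real (n s)" for s
  define e where "e = complex_of_real \<epsilon>"
  define a2 where "a2 s = 2 * e * m s * cnj (x s) * a s * a s" for s
  define b2 where "b2 s = e * m s * (4 * cnj (x s) * a s * b s - 2 * cnj (y s) * a s * a s)
      - 2 * m s * m s * cnj (x s) * a s * a s * (y s * cnj (x s) - x s * cnj (y s))" for s
  define m2 where "m2 s = - e * (x s * cnj (a s) + cnj (x s) * a s) * m s * m s" for s
  have ee: "e * e = 1" using sq by (simp add: e_def power2_eq_square flip: of_real_mult)
  have ce: "cnj e = e" "cnj (m s) = m s" for s by (simp_all add: e_def m_def)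
  have rel: "m u * (1 + e * (x u * cnj (x u))) = 1" if "u \<in> J" for u
    using n_rel(2)[OF sq nz[OF that], folded n_def] by (simp add: m_def e_def complex_eq_iff algebra_simps)
  have da: "(a has_vector_derivative a2 u) (at u)" if "u \<in> J" for u
  proof -
    have "fst (geodesic_acceleration \<epsilon> (x u, y u) (a u, b u)) = a2 u"
      unfolding geodesic_acceleration_def prod.case Let_def divide_inverse n_def[symmetric] of_real_mult e_def[symmetric] m_def[symmetric]
      by (simp add: a2_def power2_eq_square mult_ac)
    then show ?thesis using a'[OF that] by simp
  qed
  have db: "(b has_vector_derivative b2 u) (at u)" if "u \<in> J" for u
  proof -
    have "e * m u * (e * m u) = m u * m u" using ee by algebra
    then have "snd (geodesic_acceleration \<epsilon> (x u, y u) (a u, b u)) = b2 u"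
      unfolding geodesic_acceleration_def prod.case Let_def divide_inverse n_def[symmetric] of_real_mult e_def[symmetric] m_def[symmetric]
      using ee by (simp add: b2_def power2_eq_square mult_ac)
    then show ?thesis using b'[OF that] by simp
  qed
  have dm: "(m has_vector_derivative m2 u) (at u)" if "u \<in> J" for u
  proof -
    have "m2 u = of_real (- 2 * \<epsilon> * (x u \<bullet> a u) * (n u)\<^sup>2)"
      by (simp add: m2_def e_def m_def complex_eq_iff inner_complex_def power2_eq_square algebra_simps)
    then show ?thesis
      using has_vector_derivative_of_real[OF inverse_nrm_deriv[OF sq x'[OF that] nz[OF that]], folded n_def]
      by (simp only: m_def[abs_def])
  qed
  note cnjd = bounded_linear.has_vector_derivative[OF bounded_linear_cnj]
  note cnjs = complex_cnj_mult complex_cnj_add complex_cnj_diff complex_cnj_minus complex_cnj_numeral complex_cnj_cnj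
  note const = has_vector_derivative_zero_connected[OF J]
  note D = has_vector_derivative_add has_vector_derivative_diff has_vector_derivative_mult
     has_vector_derivative_const x' y' da db dm cnjd
  \<comment> \<open>The momenta as polynomials in the coordinates, velocities, their conjugates and
    \<open>m\<close>; \<open>T\<close> and \<open>T2\<close> carry the real last components as
    complex numbers.\<close>
  define W where "W u = 2 * \<i> * (m u * m u) * (a u + e * (x u * x u) * cnj (a u))" for u
  define T where "T u = - 2 * \<i> * e * (m u * m u) * (cnj (x u) * a u - x u * cnj (a u))" for u
  define W2 where "W2 u = 2 * (m u * m u) * (b u + 2 * e * x u * y u * cnj (a u) - e * x u * x u * cnj (b u))
      - 4 * e * (m u * m u * m u) * (a u + e * x u * x u * cnj (a u)) * (y u * cnj (x u) - x u * cnj (y u))" for u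
  define T2 where "T2 u = - 2 * e * (m u * m u) * (cnj (x u) * b u + x u * cnj (b u) - cnj (y u) * a u - y u * cnj (a u))
      + 4 * (m u * m u * m u) * (cnj (x u) * a u - x u * cnj (a u)) * (y u * cnj (x u) - x u * cnj (y u))" for u
  have W: "W s = W r"
  proof (rule const)
    fix u assume u: "u \<in> J"
    show "(W has_vector_derivative 0) (at u)"
      unfolding W_def[abs_def]
      by (rule has_vector_derivative_eq_rhs, (rule D u)+)
        (simp only: a2_def m2_def ce cnjs, insert rel[OF u] ee, algebra)
  qed
  have T: "T s = T r"
  proof (rule const)
    fix u assume u: "u \<in> J"
    show "(T has_vector_derivative 0) (at u)"
      unfolding T_def[abs_def]
      by (rule has_vector_derivative_eq_rhs, (rule D u)+)
        (simp add: a2_def m2_def ce algebra_simps)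
  qed
  have W2: "W2 s = W2 r"
  proof (rule const)
    fix u assume u: "u \<in> J"
    show "(W2 has_vector_derivative 0) (at u)"
      unfolding W2_def[abs_def]
      by (rule has_vector_derivative_eq_rhs, (rule D u)+)
        (simp only: a2_def m2_def b2_def ce cnjs, insert rel[OF u] ee, algebra)
  qed
  have T2: "T2 s = T2 r"
  proof (rule const)
    fix u assume u: "u \<in> J"
    show "(T2 has_vector_derivative 0) (at u)"
      unfolding T2_def[abs_def]
      by (rule has_vector_derivative_eq_rhs, (rule D u)+)
        (simp only: a2_def m2_def b2_def ce cnjs, insert rel[OF u] ee, algebra)
  qed
  have foot: "foot \<epsilon> (x u) (\<i> * a u) = (W u, Re (T u))" if "u \<in> J" for u
    by (simp add: foot_n[OF sq nz[OF that], folded n_def] W_def T_def m_def e_def power2_eq_square complex_eq_iff algebra_simps)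
  have mom: "momentum \<epsilon> (x u, y u) (a u, b u) = (W2 u, Re (T2 u))" if "u \<in> J" for u
    unfolding momentum_def prod.case Let_def n_def[symmetric]
    by (simp add: W2_def T2_def m_def e_def complex_eq_iff algebra_simps)
  show "foot \<epsilon> (x s) (\<i> * a s) = foot \<epsilon> (x r) (\<i> * a r)"
    using W T foot J by simp
  show "momentum \<epsilon> (x s, y s) (a s, b s) = momentum \<epsilon> (x r, y r) (a r, b r)"
    using W2 T2 mom J by simp
qed

end

lemma coord_geodesic_screw_curve:
  assumes eps: "\<epsilon> = 1 \<or> \<epsilon> = -1" and J: "connected J" "r \<in> J"
    and dom: "\<And>s. s \<in> J \<Longrightarrow> c s \<in> coord_dom \<epsilon>"
    and geo: "coord_geodesic (neutral_metric (conf \<epsilon>)) J c"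
  shows "\<exists>\<omega> v. screw_curve \<epsilon> \<omega> v J (\<lambda>s. line_of \<epsilon> (c s))"
proof -
  have sq: "\<epsilon>\<^sup>2 = 1" using eps by auto
  obtain c' where c': "\<And>s. s \<in> J \<Longrightarrow> (c has_vector_derivative c' s) (at s)"
    and c'': "\<And>s. s \<in> J \<Longrightarrow> (c' has_vector_derivative geodesic_acceleration \<epsilon> (c s) (c' s)) (at s)"
    using geo coord_geodesic_iff[OF eps, of J c] dom by auto
  define x y a b where "x s = fst (c s)" and "y s = snd (c s)" and "a s = fst (c' s)" and "b s = snd (c' s)" for s
  have cs: "c s = (x s, y s)" "c' s = (a s, b s)" for s by (simp_all add: x_def y_def a_def b_def)
  have pos: "nrm \<epsilon> (x s) > 0" if "s \<in> J" for s
    using nrm_pos[OF eps, of "x s" "y s"] dom[OF that] by (simp add: cs)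
  then have nz: "nrm \<epsilon> (x s) \<noteq> 0" if "s \<in> J" for s using that by force
  note fst_d = bounded_linear.has_vector_derivative[OF bounded_linear_fst]
  note snd_d = bounded_linear.has_vector_derivative[OF bounded_linear_snd]
  have x': "(x has_vector_derivative a s) (at s)" and y': "(y has_vector_derivative b s) (at s)"
    and a': "(a has_vector_derivative fst (geodesic_acceleration \<epsilon> (x s, y s) (a s, b s))) (at s)"
    and b': "(b has_vector_derivative snd (geodesic_acceleration \<epsilon> (x s, y s) (a s, b s))) (at s)" if "s \<in> J" for s
    using fst_d[OF c'[OF that]] snd_d[OF c'[OF that]] fst_d[OF c''[OF that]] snd_d[OF c''[OF that]]
    unfolding cs by (simp_all add: x_def[abs_def] y_def[abs_def] a_def[abs_def] b_def[abs_def])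
  define \<omega> where "\<omega> = foot \<epsilon> (x r) (\<i> * a r)"
  define v where "v = momentum \<epsilon> (x r, y r) (a r, b r)"
  have \<omega>: "\<omega> = foot \<epsilon> (x s) (\<i> * a s)" and v: "v = momentum \<epsilon> (x s, y s) (a s, b s)" if "s \<in> J" for s
    using momenta_constant[OF sq J(1,2) that nz x' y' a' b'] by (simp_all add: \<omega>_def v_def)
  have a: "- \<i> * incidence \<epsilon> (x s) \<omega> = a s" if "s \<in> J" for s
    unfolding \<omega>[OF that] by (simp add: incidence_foot[OF sq nz[OF that]])
  have b: "b s = spin \<epsilon> \<omega> (x s) * y s + incidence \<epsilon> (x s) v" if "s \<in> J" for s
    unfolding v[OF that] incidence_momentum(1)[OF sq nz[OF that]] by (simp add: \<omega>[OF that])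
  have K: "flat \<epsilon> \<omega> (dirn \<epsilon> (x s)) = 0" if "s \<in> J" for s
    unfolding \<omega>[OF that] by (rule flat_foot_dirn[OF sq nz[OF that]])
  have cr: "cross \<epsilon> \<omega> (dirn \<epsilon> (x s)) = foot \<epsilon> (x s) (a s)" if "s \<in> J" for s
    using cross_dirn[OF sq nz[OF that], of \<omega>] by (simp only: a[OF that])
  \<comment> \<open>The feet themselves need not follow the flow, which may move the origin. The
    foot at the single time \<open>r\<close> is therefore carried along and shown below to stay on
    the lines.\<close>
  define p where "p s = flow \<epsilon> \<omega> v (s - r) (foot \<epsilon> (x r) (y r))" for s
  have p': "(p has_vector_derivative cross \<epsilon> \<omega> (p s) + v) (at s)" for s
    unfolding p_def[abs_def] by (rule flow_deriv_shift[OF sq])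
  have pr: "p r = foot \<epsilon> (x r) (y r)" by (simp add: p_def flow_0[OF sq])
  have e': "((\<lambda>s. dirn \<epsilon> (x s)) has_vector_derivative cross \<epsilon> \<omega> (dirn \<epsilon> (x s))) (at s)" if "s \<in> J" for s
    unfolding cr[OF that] by (rule dirn_deriv[OF sq x'[OF that] nz[OF that]])
  have K2: "flat \<epsilon> v (dirn \<epsilon> (x s)) = flat \<epsilon> (cross \<epsilon> \<omega> (dirn \<epsilon> (x s))) (p s)" if "s \<in> J" for s
  proof -
    have "flat \<epsilon> v (dirn \<epsilon> (x r)) = flat \<epsilon> (cross \<epsilon> \<omega> (dirn \<epsilon> (x r))) (p r)"
      unfolding cr[OF J(2)] pr v_def by (rule incidence_momentum(2)[OF sq nz[OF J(2)]])
    then show ?thesis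
      using screw_invariants(3)[OF sq J(1) that J(2) e' p'] by simp
  qed
  \<comment> \<open>\<open>d s\<close> vanishes exactly when \<open>p s\<close> lies on the line
    with coordinates \<open>c s\<close>. Its equation has a coefficient varying with
    \<open>s\<close>, whereas \<open>linear_ode_zero\<close> takes a fixed operator; a conserved
    norm replaces it.\<close>
  define d where "d s = incidence \<epsilon> (x s) (p s) - y s" for s
  have d': "(d has_vector_derivative spin \<epsilon> \<omega> (x s) * d s) (at s)" if "s \<in> J" for s
  proof -
    have "incidence \<epsilon> (x s) (cross \<epsilon> \<omega> (p s) + v)
        - (of_real (snd (p s)) + of_real \<epsilon> * cnj (fst (p s)) * x s) * a s - b s = spin \<epsilon> \<omega> (x s) * d s"
      using incidence_cross[OF sq, of "x s" \<omega> "p s"]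
      unfolding incidence_add[OF sq] b[OF that] d_def a[OF that] by algebra
    then show ?thesis
      using has_vector_derivative_diff[OF incidence_deriv[OF sq x'[OF that] p'] y'[OF that]]
      by (simp only: d_def[abs_def])
  qed
  \<comment> \<open>The deviation \<open>d\<close> is transported isometrically, so its norm in the metric of \<open>N\<close> is constant.\<close>
  define f where "f s = (d s \<bullet> d s) * (inverse (nrm \<epsilon> (x s)))\<^sup>2" for s
  have f': "(f has_vector_derivative 0) (at s)" if "s \<in> J" for s
  proof -
    define n where "n s = inverse (nrm \<epsilon> (x s))" for s
    have n': "(n has_real_derivative - 2 * \<epsilon> * (x s \<bullet> a s) * (n s)\<^sup>2) (at s)"
      unfolding n_def[abs_def] by (rule inverse_nrm_deriv[OF sq x'[OF that] nz[OF that]])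
    have "spin \<epsilon> \<omega> (x s) = 2 * of_real (\<epsilon> * n s) * cnj (x s) * a s"
      using spin_eq[OF sq nz[OF that] K[OF that]] by (simp only: a[OF that] n_def)
    then have "d s \<bullet> (spin \<epsilon> \<omega> (x s) * d s) = 2 * \<epsilon> * n s * (x s \<bullet> a s) * (d s \<bullet> d s)"
      by (simp add: inner_complex_def algebra_simps)
    moreover have "((\<lambda>s. d s \<bullet> d s) has_real_derivative 2 * (d s \<bullet> (spin \<epsilon> \<omega> (x s) * d s))) (at s)"
      using bounded_bilinear.has_vector_derivative[OF bounded_bilinear_inner d'[OF that] d'[OF that]]
      by (simp add: has_real_derivative_iff_has_vector_derivative inner_commute)
    ultimately have "((\<lambda>s. d s \<bullet> d s) has_real_derivative 4 * \<epsilon> * n s * (x s \<bullet> a s) * (d s \<bullet> d s)) (at s)"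
      by (simp add: mult.assoc)
    from DERIV_mult[OF this DERIV_mult[OF n' n']] have "(f has_real_derivative 0) (at s)"
      by (simp add: f_def[abs_def] n_def power2_eq_square algebra_simps)
    then show ?thesis by (simp add: has_real_derivative_iff_has_vector_derivative)
  qed
  have f0: "f s = 0" if "s \<in> J" for s
  proof -
    have "d r = 0" by (simp add: d_def pr incidence_foot[OF sq nz[OF J(2)]])
    then have "f r = 0" by (simp add: f_def)
    then show ?thesis using has_vector_derivative_zero_connected[OF J(1) that J(2) f'] by simp
  qed
  have d0: "incidence \<epsilon> (x s) (p s) = y s" if "s \<in> J" for s
    using f0[OF that] nz[OF that] by (simp add: f_def d_def)
  have line: "line_of \<epsilon> (c s) = oriented_line (p s) (dirn \<epsilon> (x s))" if "s \<in> J" for s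
    unfolding cs d0[OF that, symmetric] by (rule line_of_incidence[OF sq nz[OF that]])
  have fut: "\<epsilon> = -1 \<longrightarrow> snd (dirn \<epsilon> (x s)) > 0" if "s \<in> J" for s
  proof
    assume "\<epsilon> = -1"
    then have "nrm \<epsilon> (x s) \<le> 1" by (simp add: nrm_def)
    then show "snd (dirn \<epsilon> (x s)) > 0"
      using pos[OF that] by (simp add: dirn_def field_simps)
  qed
  have "screw_curve \<epsilon> \<omega> v J (\<lambda>s. line_of \<epsilon> (c s))"
    unfolding screw_curve_def
    by (rule exI[of _ "\<lambda>s. dirn \<epsilon> (x s)"], rule exI[of _ p])
      (use e' p' K K2 line fut flat_dirn[OF sq nz] in blast)
  then show ?thesis by blast
qed

lemma geodesic_locally_screw_curve:
  assumes eps: "\<epsilon> = 1 \<or> \<epsilon> = -1" and g: "geodesic \<epsilon> I \<gamma>" and s: "s \<in> I"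
  shows "\<exists>\<omega> v J. open J \<and> s \<in> J \<and> connected J \<and> screw_curve \<epsilon> \<omega> v J \<gamma>"
proof -
  from g s have "\<exists>\<kappa>\<in>charts \<epsilon>. \<exists>J c. open J \<and> s \<in> J \<and> J \<subseteq> I \<and>
      (\<forall>r\<in>J. c r \<in> coord_dom \<epsilon> \<and> \<gamma> r = \<kappa> (c r)) \<and> coord_geodesic (neutral_metric (conf \<epsilon>)) J c"
    unfolding geodesic_def by (elim conjE) (rule bspec)
  then obtain \<kappa> J c where \<kappa>: "\<kappa> \<in> charts \<epsilon>" and J: "open J" "s \<in> J"
    and c': "\<forall>r\<in>J. c r \<in> coord_dom \<epsilon> \<and> \<gamma> r = \<kappa> (c r)"
    and geo: "coord_geodesic (neutral_metric (conf \<epsilon>)) J c"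
    by (elim bexE exE conjE)
  from c' have c: "\<And>r. r \<in> J \<Longrightarrow> c r \<in> coord_dom \<epsilon>" "\<And>r. r \<in> J \<Longrightarrow> \<gamma> r = \<kappa> (c r)"
    by simp_all
  \<comment> \<open>\<open>J\<close> may be disconnected, and the momenta are constant only along
    connected sets of times.\<close>
  obtain \<delta> where \<delta>: "\<delta> > 0" "ball s \<delta> \<subseteq> J" using J openE by blast
  define B where "B = ball s \<delta>"
  have B: "open B" "s \<in> B" "connected B" "B \<subseteq> J" using \<delta> by (auto simp: B_def)
  have "coord_geodesic (neutral_metric (conf \<epsilon>)) B c"
    using geo B(4) unfolding coord_geodesic_def by blast
  from coord_geodesic_screw_curve[OF eps B(3,2) _ this]
  obtain \<omega> v where sc: "screw_curve \<epsilon> \<omega> v B (\<lambda>s. line_of \<epsilon> (c s))"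
    using c(1) B(4) by blast
  have cong: "screw_curve \<epsilon> \<omega> v B \<gamma>"
    if "screw_curve \<epsilon> \<omega> v B \<gamma>'" "\<And>r. r \<in> B \<Longrightarrow> \<gamma> r = \<gamma>' r" for \<omega> v \<gamma>'
    using that unfolding screw_curve_def by (elim exE) (intro exI, auto)
  consider "\<kappa> = line_of \<epsilon>" | "\<epsilon> = 1" "\<kappa> = act half_turn \<circ> line_of \<epsilon>"
    using \<kappa> by (auto simp: charts_def split: if_splits)
  then show ?thesis
  proof cases
    case 1
    have "screw_curve \<epsilon> \<omega> v B \<gamma>"
      by (rule cong[OF sc]) (use c(2) B(4) 1 in auto)
    then show ?thesis using B by blast
  next
    case 2
    have "screw_curve \<epsilon> (half_turn \<omega>) (half_turn v) B \<gamma>"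
      by (rule cong[OF screw_curve_half_turn[OF sc[unfolded 2(1)], folded 2(1)]]) (use c(2) B(4) 2(2) in auto)
    then show ?thesis using B by blast
  qed
qed

theorem theorem2:
  fixes \<epsilon> :: real and I :: "real set" and \<gamma> :: "real \<Rightarrow> oline"
  assumes "\<epsilon> = 1 \<or> \<epsilon> = -1"
    and "geodesic \<epsilon> I \<gamma>"
  shows "\<exists>\<phi> l. one_parameter_subgroup \<epsilon> \<phi> \<and> l \<in> lines \<epsilon> \<and>
           (\<forall>s\<in>I. \<gamma> s = act (\<phi> s) l) \<and>
           (maximal_geodesic \<epsilon> I \<gamma> \<longrightarrow> \<gamma> ` I = range (\<lambda>s. act (\<phi> s) l))"
proof -
  have sq: "\<epsilon>\<^sup>2 = 1" using assms(1) by auto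
  have I: "connected I" "I \<noteq> {}" using assms(2) by (auto simp: geodesic_def)
  obtain \<omega> v where "\<And>s. s \<in> I \<Longrightarrow> \<exists>J. open J \<and> s \<in> J \<and> connected J \<and> screw_curve \<epsilon> \<omega> v J \<gamma>"
    using screw_curve_global[OF sq I(1), of \<gamma>] geodesic_locally_screw_curve[OF assms] by blast
  from screw_curve_act[OF sq I this] obtain l where
    l: "\<forall>s\<in>I. \<gamma> s = act (flow \<epsilon> \<omega> v s) l" and sc: "screw_curve \<epsilon> \<omega> v UNIV (\<lambda>s. act (flow \<epsilon> \<omega> v s) l)"
    by blast
  have l_eq: "act (flow \<epsilon> \<omega> v 0) l = l"
    by (simp add: act_def map_prod_def case_prod_beta flow_0[OF sq])
  obtain p e where pe: "flat \<epsilon> e e = \<epsilon>" "\<epsilon> = -1 \<longrightarrow> snd e > 0" "l = oriented_line p e"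
    using sc l_eq unfolding screw_curve_def by (metis UNIV_I)
  have "if \<epsilon> = 1 then e \<noteq> 0 else flat \<epsilon> e e < 0 \<and> snd e > 0"
    using assms(1) pe(1,2) by (auto simp: flat_def)
  then have "l \<in> lines \<epsilon>"
    unfolding lines_def pe(3) by blast
  moreover have "I = UNIV" if "maximal_geodesic \<epsilon> I \<gamma>"
  proof -
    have "\<forall>I' \<gamma>'. geodesic \<epsilon> I' \<gamma>' \<and> I \<subseteq> I' \<and> (\<forall>s\<in>I. \<gamma>' s = \<gamma> s) \<longrightarrow> I' = I"
      using that unfolding maximal_geodesic_def by (rule conjunct2)
    from this[rule_format, OF conjI, OF geodesic_screw_curve[OF assms(1) sc]]
    show ?thesis using l by simp
  qed
  ultimately show ?thesis
    using one_parameter_subgroup_flow[OF sq] l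
    by (intro exI[of _ "flow \<epsilon> \<omega> v"] exI[of _ l]) auto
qed

end
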